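(* The potential $q$ on $[0,a]$ is a function only of its $A$-function on $[0,a]$. Explicitly: let $(q_1,b_1,h_1)$ and $(q_2,b_2,h_2)$ be two potentials with $A$-functions $A_1$ and $A_2$, and let $a>0$ with $a<b_1$ and $a<b_2$. If $A_1(\alpha)=A_2(\alpha)$ for (a.e.) $\alpha\in[0,a]$, then $q_1(x)=q_2(x)$ for (a.e.) $x\in[0,a]$.
   Context: A potential is a triple $(q,b,h)$ with $0<b\le\infty$ and $q$ a real-valued measurable function on $(0,b)$. If $b<\infty$, assume $\int_0^b|q(x)|\,dx<\infty$ and $h\in\mathbb{R}\cup\{\infty\}$, specifying the boundary condition $u'(b)+hu(b)=0$ ($h=\infty$ means $u(b)=0$). If $b=\infty$, there is no $h$, and assume $\int_y^{y+1}|q(x)|\,dx<\infty$ for all $y\ge0$ and $\sup_{y>0}\int_y^{y+1}\max(-q(x),0)\,dx<\infty$ (so that $-\frac{d^2}{dx^2}+q$ is limit point at infinity). For $z\in\mathbb{C}\setminus[\beta,\infty)$ with $-\beta$ sufficiently large there is, up to a constant multiple, a unique nonzero solution $u(x,z)$ of $-u''+qu=zu$ on $(0,b)$ which satisfies the boundary condition at $b$ if $b<\infty$, or is $L^2$ at infinity if $b=\infty$. The $m$-function is $m(z)=u'(0,z)/u(0,z)$. The $A$-function of a potential is the (a.e. unique, and always existing) function $A$ on $(0,b)$, integrable on $(0,a)$ for every finite $a\le b$, such that for every finite $a\le b$, $m(-\kappa^2)=-\kappa-\int_0^aA(\alpha)e^{-2\alpha\kappa}\,d\alpha+\tilde O(e^{-2a\kappa})$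 as $\kappa\to\infty$. Notation: if $g\to0$ as $x\to x_0$, then $f=\tilde O(g)$ as $x\to x_0$ means $\lim_{x\to x_0}|f(x)|/|g(x)|^{1-\varepsilon}=0$ for every $\varepsilon>0$. *)

theory Defs
  imports "HOL-Analysis.Analysis"
begin

text \<open>
  A potential is a triple \<open>(q, b, h)\<close>, where \<open>b = \<infinity>\<close> is allowed and \<open>h = \<infinity>\<close> stands for the
  Dirichlet condition at a finite \<open>b\<close>. If \<open>b = \<infinity>\<close> there is no boundary condition, and the
  component \<open>h\<close> is a dummy which no definition below looks at. Functions on \<open>(0, b)\<close> are total
  functions on the reals whose values outside \<open>(0, b)\<close> are irrelevant.
\<close>

definition is_potential :: "(real \<Rightarrow> real) \<Rightarrow> ereal \<Rightarrow> ereal \<Rightarrow> bool" where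
  "is_potential q b h \<longleftrightarrow>
     0 < b \<and>
     q \<in> borel_measurable (lebesgue_on {x. 0 < x \<and> ereal x < b}) \<and>
     (b < \<infinity> \<longrightarrow> q absolutely_integrable_on {x. 0 < x \<and> ereal x < b} \<and> h \<noteq> -\<infinity>) \<and>
     (b = \<infinity> \<longrightarrow>
        (\<forall>y\<ge>0. q absolutely_integrable_on {y<..<y + 1}) \<and>
        bdd_above ((\<lambda>y. integral {y<..<y + 1} (\<lambda>x. max (- q x) 0)) ` {0<..}))"

text \<open>The interval \<open>[0, b]\<close> if \<open>b < \<infinity>\<close>, and \<open>[0, \<infinity>)\<close> if \<open>b = \<infinity>\<close>.\<close>

definition sol_dom :: "ereal \<Rightarrow> real set" where
  "sol_dom b = {x. 0 \<le> x \<and> ereal x \<le> b}"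

text \<open>The derivative on that interval, one-sided at its end points.\<close>

definition sol_deriv :: "ereal \<Rightarrow> (real \<Rightarrow> complex) \<Rightarrow> real \<Rightarrow> complex" where
  "sol_deriv b u x = vector_derivative u (at x within sol_dom b)"

text \<open>
  As \<open>q\<close> is only locally integrable, \<open>-u'' + q u = z u\<close> has the usual (Caratheodory) meaning:
  \<open>u\<close> is continuously differentiable, \<open>u'\<close> is locally absolutely continuous (that is, the
  indefinite integral of a locally integrable function \<open>u''\<close>), and the equation holds almost
  everywhere. Near a finite end point \<open>q\<close> is integrable, so that \<open>u\<close> and \<open>u'\<close> extend
  continuously to it.
\<close>

definition schroedinger_solution ::
    "(real \<Rightarrow> real) \<Rightarrow> ereal \<Rightarrow> complex \<Rightarrow> (real \<Rightarrow> complex) \<Rightarrow> bool" where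
  "schroedinger_solution q b z u \<longleftrightarrow>
     (\<forall>x\<in>sol_dom b. u differentiable (at x within sol_dom b)) \<and>
     (\<exists>u''.
        (\<forall>x\<in>sol_dom b. u'' absolutely_integrable_on {0..x} \<and>
            sol_deriv b u x = sol_deriv b u 0 + integral {0..x} u'') \<and>
        (AE x in lebesgue. 0 < x \<and> ereal x < b \<longrightarrow>
            - u'' x + of_real (q x) * u x = z * u x))"

definition boundary_condition :: "ereal \<Rightarrow> ereal \<Rightarrow> (real \<Rightarrow> complex) \<Rightarrow> bool" where
  "boundary_condition b h u \<longleftrightarrow>
     (if h = \<infinity> then u (real_of_ereal b) = 0
      else sol_deriv b u (real_of_ereal b)
             + of_real (real_of_ereal h) * u (real_of_ereal b) = 0)"

definition L2_at_infinity :: "(real \<Rightarrow> complex) \<Rightarrow> bool" where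
  "L2_at_infinity u \<longleftrightarrow> (\<exists>c\<ge>0. (\<lambda>x. (cmod (u x))\<^sup>2) absolutely_integrable_on {c..})"

definition is_weyl_solution ::
    "(real \<Rightarrow> real) \<Rightarrow> ereal \<Rightarrow> ereal \<Rightarrow> complex \<Rightarrow> (real \<Rightarrow> complex) \<Rightarrow> bool" where
  "is_weyl_solution q b h z u \<longleftrightarrow>
     schroedinger_solution q b z u \<and>
     (\<exists>x\<in>sol_dom b. u x \<noteq> 0) \<and>
     (if b < \<infinity> then boundary_condition b h u else L2_at_infinity u)"

text \<open>
  The solution is determined only up to a constant multiple (for \<open>z\<close> off a half line
  \<open>[\<beta>, \<infinity>)\<close>), and the quotient defining \<open>m\<close> does not depend on the choice.
\<close>

definition weyl_solution ::
    "(real \<Rightarrow> real) \<Rightarrow> ereal \<Rightarrow> ereal \<Rightarrow> complex \<Rightarrow> real \<Rightarrow> complex" where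
  "weyl_solution q b h z = (SOME u. is_weyl_solution q b h z u)"

definition m_function :: "(real \<Rightarrow> real) \<Rightarrow> ereal \<Rightarrow> ereal \<Rightarrow> complex \<Rightarrow> complex" where
  "m_function q b h z = sol_deriv b (weyl_solution q b h z) 0 / weyl_solution q b h z 0"

text \<open>\<open>f = O~(g)\<close> along the filter \<open>F\<close>, a notion used only if \<open>g\<close> tends to \<open>0\<close>.\<close>

definition soft_O :: "'a filter \<Rightarrow> ('a \<Rightarrow> complex) \<Rightarrow> ('a \<Rightarrow> real) \<Rightarrow> bool" where
  "soft_O F f g \<longleftrightarrow>
     (g \<longlongrightarrow> 0) F \<and>
     (\<forall>\<epsilon>>0. ((\<lambda>x. cmod (f x) / \<bar>g x\<bar> powr (1 - \<epsilon>)) \<longlongrightarrow> 0) F)"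

definition is_A_function ::
    "(real \<Rightarrow> real) \<Rightarrow> ereal \<Rightarrow> ereal \<Rightarrow> (real \<Rightarrow> real) \<Rightarrow> bool" where
  "is_A_function q b h A \<longleftrightarrow>
     (\<forall>a::real. 0 < a \<and> ereal a \<le> b \<longrightarrow>
        A absolutely_integrable_on {0<..<a} \<and>
        soft_O at_top
          (\<lambda>\<kappa>. m_function q b h (- (of_real \<kappa>)\<^sup>2)
                 - (- of_real \<kappa>
                    - of_real (integral {0<..<a} (\<lambda>\<alpha>. A \<alpha> * exp (- 2 * \<alpha> * \<kappa>)))))
          (\<lambda>\<kappa>. exp (- 2 * a * \<kappa>)))"

end

theory Submission
  imports Defs "HOL-Complex_Analysis.Complex_Analysis" "HOL-Real_Asymp.Real_Asymp"
begin

text \<open>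
  Let \<open>\<phi>\<close> and \<open>\<theta>\<close> be the solutions of \<open>-y'' + q y = z y\<close> with \<open>\<phi>(0) = 0, \<phi>'(0) = 1\<close> and
  \<open>\<theta>(0) = 1, \<theta>'(0) = 0\<close>, so that \<open>\<theta> + m \<phi>\<close> is the Weyl solution \<open>\<psi>\<close>. For a fixed \<open>x\<close> in \<open>(0, a)\<close>,
  \<open>F(z) = \<phi>\<^sub>1 \<theta>\<^sub>2 - \<phi>\<^sub>2 \<theta>\<^sub>1 = \<phi>\<^sub>1 \<psi>\<^sub>2 - \<phi>\<^sub>2 \<psi>\<^sub>1 + (m\<^sub>1 - m\<^sub>2) \<phi>\<^sub>1 \<phi>\<^sub>2\<close>
  is entire in \<open>z\<close>. At \<open>z = -\<kappa>\<^sup>2\<close> one has \<open>\<phi> = O(e\<^bsup>\<kappa>x\<^esup> / \<kappa>)\<close> and \<open>\<psi> = O(e\<^bsup>-\<kappa>x\<^esup>)\<close>, while equality of the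
  \<open>A\<close>-functions on \<open>[0, a]\<close> makes \<open>m\<^sub>1 - m\<^sub>2 = o(e\<^bsup>-2\<kappa>x\<^esup>)\<close>; hence \<open>F(-\<kappa>\<^sup>2) \<rightarrow> 0\<close>. As a function of
  \<open>k\<close>, \<open>F(k\<^sup>2)\<close> has exponential type and is bounded on both axes, so by Phragmen-Lindelof and Liouville
  it is constant, and therefore \<open>0\<close>. Together with the constancy of the Wronskian, \<open>\<phi>\<^sub>1 \<theta>\<^sub>2 = \<phi>\<^sub>2 \<theta>\<^sub>1\<close> on
  \<open>[0, a]\<close> gives \<open>\<phi>\<^sub>1\<^sup>2 = \<phi>\<^sub>2\<^sup>2\<close> and \<open>\<theta>\<^sub>1\<^sup>2 = \<theta>\<^sub>2\<^sup>2\<close>, and differentiating twice recovers \<open>q\<^sub>1 = q\<^sub>2\<close>.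

  The decay of \<open>\<psi>\<close> needs no limit point theory: a suitable correction of \<open>Re (\<psi>' \<psi>\<^sup>*)\<close> is
  nondecreasing for large \<open>\<kappa>\<close>, and it is nonpositive at some point to the right of \<open>a\<close>, because of the
  boundary condition or because \<open>|\<psi>|\<^sup>2\<close> is integrable.
\<close>

subsection \<open>Absolutely continuous functions\<close>

text \<open>
  \<open>F\<close> is absolutely continuous on \<open>[0, c]\<close>, with derivative \<open>f\<close> almost everywhere.
\<close>

definition is_primitive ::
    "(real \<Rightarrow> 'a::euclidean_space) \<Rightarrow> (real \<Rightarrow> 'a) \<Rightarrow> real \<Rightarrow> bool" where
  "is_primitive F f c \<longleftrightarrow>
     f absolutely_integrable_on {0..c} \<and> (\<forall>x\<in>{0..c}. F x = F 0 + integral {0..x} f)"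

lemma is_primitive_absolutely_integrable:
  "is_primitive F f c \<Longrightarrow> f absolutely_integrable_on {0..c}"
  by (simp add: is_primitive_def)

lemma is_primitive_eq:
  "is_primitive F f c \<Longrightarrow> 0 \<le> x \<Longrightarrow> x \<le> c \<Longrightarrow> F x = F 0 + integral {0..x} f"
  unfolding is_primitive_def by (metis atLeastAtMost_iff)

lemma is_primitive_subinterval:
  fixes f :: "real \<Rightarrow> 'a::euclidean_space"
  assumes "is_primitive F f c" "0 \<le> x" "y \<le> c"
  shows "f absolutely_integrable_on {x..y}" "f integrable_on {x..y}"
proof -
  show "f absolutely_integrable_on {x..y}"
    using is_primitive_absolutely_integrable[OF assms(1)] assms(2,3)
    by (auto intro: absolutely_integrable_on_subinterval[where S = "{0..c}"])
  then show "f integrable_on {x..y}"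
    using absolutely_integrable_on_def by blast
qed

lemma is_primitive_diff:
  assumes "is_primitive F f c" "0 \<le> x" "x \<le> y" "y \<le> c"
  shows "F y - F x = integral {x..y} f"
proof -
  have "F x = F 0 + integral {0..x} f" "F y = F 0 + integral {0..y} f"
    using assms by (auto intro: is_primitive_eq)
  moreover have "integral {0..x} f + integral {x..y} f = integral {0..y} f"
    using assms is_primitive_subinterval(2)[OF assms(1), of 0 y] by (simp add: Henstock_Kurzweil_Integration.integral_combine)
  ultimately show ?thesis by (simp add: algebra_simps)
qed

lemma is_primitive_continuous_on:
  assumes "is_primitive F f c"
  shows "continuous_on {0..c} F"
proof -
  have "continuous_on {0..c} (\<lambda>x. F 0 + integral {0..x} f)"
    using is_primitive_absolutely_integrable[OF assms] unfolding absolutely_integrable_on_def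
    by (intro continuous_intros indefinite_integral_continuous_1) auto
  then show ?thesis
    by (rule continuous_on_eq) (metis is_primitive_eq[OF assms] atLeastAtMost_iff)
qed

lemma is_primitive_cong:
  assumes "is_primitive F f c" "\<And>x. x \<in> {0..c} \<Longrightarrow> G x = F x"
    and "AE x in lebesgue. x \<in> {0..c} \<longrightarrow> g x = f x"
  shows "is_primitive G g c"
proof -
  have neg: "negligible {x. \<not> (x \<in> {0..c} \<longrightarrow> g x = f x)}"
    using assms(3) by (simp add: AE_iff_null_sets negligible_iff_null_sets completion.AE_iff_null_sets)
  have "g absolutely_integrable_on {0..c}"
    by (rule absolutely_integrable_spike[OF is_primitive_absolutely_integrable[OF assms(1)] neg]) auto
  moreover have "integral {0..x} g = integral {0..x} f" if "x \<in> {0..c}" for x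
    by (rule integral_spike[OF neg]) (use that in auto)
  moreover have "G x = G 0 + integral {0..x} f" if "x \<in> {0..c}" for x
    using that assms(2)[of x] assms(2)[of 0] is_primitive_eq[OF assms(1), of x] by simp
  ultimately show ?thesis
    unfolding is_primitive_def by metis
qed

lemma is_primitive_const: "is_primitive (\<lambda>x. k) (\<lambda>x. 0) c"
  by (simp add: is_primitive_def)

lemma is_primitiveI:
  assumes "f absolutely_integrable_on {0..c}"
    and "\<And>x. 0 \<le> x \<Longrightarrow> x \<le> c \<Longrightarrow> F x = F 0 + integral {0..x} f"
  shows "is_primitive F f c"
  unfolding is_primitive_def using assms by (metis atLeastAtMost_iff)

lemma is_primitive_add:
  assumes F: "is_primitive F f c" and G: "is_primitive G g c"
  shows "is_primitive (\<lambda>x. F x + G x) (\<lambda>x. f x + g x) c"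
proof (rule is_primitiveI)
  show "(\<lambda>x. f x + g x) absolutely_integrable_on {0..c}"
    by (rule set_integral_add[OF is_primitive_absolutely_integrable[OF F] is_primitive_absolutely_integrable[OF G]])
  fix x assume x: "0 \<le> x" "x \<le> c"
  have "integral {0..x} (\<lambda>x. f x + g x) = integral {0..x} f + integral {0..x} g"
    by (rule Henstock_Kurzweil_Integration.integral_add)
      (rule is_primitive_subinterval(2)[OF F order_refl x(2)],
        rule is_primitive_subinterval(2)[OF G order_refl x(2)])
  moreover note is_primitive_eq[OF F x] is_primitive_eq[OF G x]
  ultimately show "F x + G x = F 0 + G 0 + integral {0..x} (\<lambda>x. f x + g x)"
    by (metis (no_types, lifting) add.assoc add.left_commute)
qed

lemma is_primitive_linear:
  assumes "is_primitive F f c" "bounded_linear h"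
  shows "is_primitive (\<lambda>x. h (F x)) (\<lambda>x. h (f x)) c"
proof -
  interpret h: bounded_linear h by fact
  have "integral {0..x} (\<lambda>x. h (f x)) = h (integral {0..x} f)" if "x \<in> {0..c}" for x
    using integral_linear[of f "{0..x}" h] is_primitive_subinterval[OF assms(1), of 0 x] that assms(2)
    by (simp add: o_def)
  moreover have "(\<lambda>x. h (f x)) absolutely_integrable_on {0..c}"
    using absolutely_integrable_linear[of "{0..c}" f h] is_primitive_absolutely_integrable[OF assms(1)] assms(2)
    by (simp add: o_def)
  ultimately show ?thesis
    using is_primitive_eq[OF assms(1)] h.add unfolding is_primitive_def by (metis atLeastAtMost_iff)
qed

lemma is_primitive_minus:
  assumes "is_primitive F f c" "is_primitive G g c"
  shows "is_primitive (\<lambda>x. F x - G x) (\<lambda>x. f x - g x) c"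
  using is_primitive_add[OF assms(1) is_primitive_linear[OF assms(2), of uminus]]
  by (simp add: bounded_linear_minus)

lemma is_primitiveI_C1:
  assumes "\<And>x. x \<in> {0..c} \<Longrightarrow> (F has_vector_derivative f x) (at x within {0..c})"
    and "continuous_on {0..c} f"
  shows "is_primitive F f c"
  unfolding is_primitive_def
proof
  show "f absolutely_integrable_on {0..c}"
    using assms(2) by (rule absolutely_integrable_continuous_real)
  show "\<forall>x\<in>{0..c}. F x = F 0 + integral {0..x} f"
  proof
    fix x assume x: "x \<in> {0..c}"
    have "(f has_integral F x - F 0) {0..x}"
      by (rule fundamental_theorem_of_calculus)
        (use x assms(1) in \<open>auto intro: has_vector_derivative_within_subset[where S = "{0..c}"]\<close>)
    then show "F x = F 0 + integral {0..x} f"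
      by (simp add: integral_unique)
  qed
qed

lemma is_primitive_integral:
  assumes "f absolutely_integrable_on {0..c}"
  shows "is_primitive (\<lambda>x. k + integral {0..x} f) f c"
  using assms by (simp add: is_primitive_def)

lemma is_primitive_has_vector_derivative:
  assumes "is_primitive F f c" "continuous_on {0..c} f" "x \<in> {0..c}"
  shows "(F has_vector_derivative f x) (at x within {0..c})"
proof (rule has_vector_derivative_transform[OF \<open>x \<in> {0..c}\<close>])
  show "((\<lambda>x. F 0 + integral {0..x} f) has_vector_derivative f x) (at x within {0..c})"
    using integral_has_vector_derivative[OF assms(2,3)]
    by (auto intro!: derivative_eq_intros)
  show "F y = F 0 + integral {0..y} f" if "y \<in> {0..c}" for y
    using is_primitive_eq[OF assms(1), of y] that by (metis atLeastAtMost_iff)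
qed

text \<open>Telescoping over a fine partition gives
  \<open>norm (D c - D 0) \<le> e * (M c - M 0)\<close> for every \<open>e > 0\<close>. With
  \<open>M\<close> the integral of a dominating function, this replaces differentiation almost
  everywhere in the proof of the product rule.\<close>

lemma constant_if_small_increments:
  fixes D :: "real \<Rightarrow> 'a::real_normed_vector" and M :: "real \<Rightarrow> real"
  assumes "0 \<le> c"
    and small: "\<And>e. e > 0 \<Longrightarrow> \<exists>d>0. \<forall>x y. 0 \<le> x \<and> x \<le> y \<and> y \<le> c \<and> y - x < d \<longrightarrow>
                  norm (D y - D x) \<le> e * (M y - M x)"
  shows "D c = D 0"
proof -
  have le: "norm (D c - D 0) \<le> e * (M c - M 0)" if "e > 0" for e
  proof -
    obtain d where "d > 0" and d: "\<And>x y. 0 \<le> x \<Longrightarrow> x \<le> y \<Longrightarrow> y \<le> c \<Longrightarrow> y - x < d \<Longrightarrow>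
                  norm (D y - D x) \<le> e * (M y - M x)"
      using small[OF \<open>e > 0\<close>] by blast
    obtain n where n: "c / d < real (Suc n)"
      using reals_Archimedean2 by (meson less_trans lessI of_nat_less_iff)
    define N where "N = Suc n"
    have N: "N > 0" "c / real N < d"
      using n \<open>d > 0\<close> by (auto simp: N_def field_simps)
    have "norm (D (c * i / N) - D 0) \<le> e * (M (c * i / N) - M 0)" if "i \<le> N" for i :: nat
      using that
    proof (induction i)
      case (Suc i)
      have "norm (D (c * Suc i / N) - D (c * i / N)) \<le> e * (M (c * Suc i / N) - M (c * i / N))"
      proof (rule d)
        show "c * real (Suc i) / real N \<le> c"
          using Suc.prems N(1) \<open>0 \<le> c\<close> by (simp add: pos_divide_le_eq mult_left_mono)
        show "c * real (Suc i) / real N - c * real i / real N < d"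
          using N by (simp add: field_simps)
      qed (use \<open>0 \<le> c\<close> in \<open>auto simp: divide_right_mono mult_left_mono\<close>)
      moreover have "norm (D (c * Suc i / N) - D 0)
          \<le> norm (D (c * Suc i / N) - D (c * i / N)) + norm (D (c * i / N) - D 0)"
        by (metis diff_add_cancel diff_add_eq norm_triangle_ineq add_diff_eq)
      ultimately show ?case
        using Suc by (simp add: algebra_simps)
    qed simp
    from this[of N] show ?thesis using N(1) by simp
  qed
  have "norm (D c - D 0) \<le> 0"
  proof (rule field_le_epsilon)
    fix e :: real assume "e > 0"
    \<comment> \<open>The \<open>+ 1\<close> keeps the divisor positive when
      \<open>M c = M 0\<close>.\<close>
    define K where "K = \<bar>M c - M 0\<bar> + 1"
    have "K > 0" by (simp add: K_def)
    have "norm (D c - D 0) \<le> e / K * (M c - M 0)"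
      using \<open>e > 0\<close> \<open>K > 0\<close> by (intro le) simp
    also have "\<dots> \<le> e / K * K"
      using \<open>e > 0\<close> \<open>K > 0\<close> by (intro mult_left_mono) (auto simp: K_def)
    finally show "norm (D c - D 0) \<le> 0 + e" using \<open>K > 0\<close> by simp
  qed
  then show ?thesis by simp
qed

lemma absolutely_integrable_bilinear_continuous:
  fixes h :: "'a::euclidean_space \<Rightarrow> 'b::euclidean_space \<Rightarrow> 'c::euclidean_space"
  assumes "bounded_bilinear h" "continuous_on {a..b::real} f" "g absolutely_integrable_on {a..b}"
  shows "(\<lambda>x. h (f x) (g x)) absolutely_integrable_on {a..b}"
    "(\<lambda>x. h (f x) (g x)) integrable_on {a..b}"
proof -
  show "(\<lambda>x. h (f x) (g x)) absolutely_integrable_on {a..b}"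
  proof (rule absolutely_integrable_bounded_measurable_product[of h f _ g])
    show "bilinear h"
      using assms(1) by (simp add: bilinear_conv_bounded_bilinear)
    show "f \<in> borel_measurable (lebesgue_on {a..b})"
      using assms(2) by (simp add: continuous_imp_measurable_on_sets_lebesgue)
    show "bounded (f ` {a..b})"
      using assms(2) compact_continuous_image compact_imp_bounded by blast
  qed (use assms in auto)
  then show "(\<lambda>x. h (f x) (g x)) integrable_on {a..b}"
    using absolutely_integrable_on_def by blast
qed

text \<open>The product rule for absolutely continuous functions, without pointwise derivatives. On
  a short interval \<open>{u..v}\<close> the increment of \<open>h (F x) (G x)\<close> is the
  integral of \<open>h (f s) (G v) + h (F u) (g s)\<close>, and by uniform continuity this differs
  from the claimed integrand by a small multiple of \<open>norm (f s) + norm (g s)\<close>.\<close>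

lemma is_primitive_bilinear:
  fixes h :: "'a::euclidean_space \<Rightarrow> 'b::euclidean_space \<Rightarrow> 'c::euclidean_space"
  assumes h: "bounded_bilinear h" and F: "is_primitive F f c" and G: "is_primitive G g c"
  shows "is_primitive (\<lambda>x. h (F x) (G x)) (\<lambda>x. h (f x) (G x) + h (F x) (g x)) c"
proof -
  interpret h: bounded_bilinear h by fact
  obtain K where "K > 0" and K: "\<And>x y. norm (h x y) \<le> norm x * norm y * K"
    using h.pos_bounded by blast
  have contF: "continuous_on {0..c} F" and contG: "continuous_on {0..c} G"
    using F G is_primitive_continuous_on by blast+
  have flip: "bounded_bilinear (\<lambda>x y. h y x)" by (rule h.flip)
  note fabs = is_primitive_subinterval[OF F] and gabs = is_primitive_subinterval[OF G]
  have ai1: "(\<lambda>x. h (f x) (G x)) absolutely_integrable_on {x..y}"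
    "(\<lambda>x. h (f x) (G x)) integrable_on {x..y}" if "0 \<le> x" "y \<le> c" for x y
    using absolutely_integrable_bilinear_continuous[OF flip continuous_on_subset[OF contG] fabs(1)] that
    by auto
  have ai2: "(\<lambda>x. h (F x) (g x)) absolutely_integrable_on {x..y}"
    "(\<lambda>x. h (F x) (g x)) integrable_on {x..y}" if "0 \<le> x" "y \<le> c" for x y
    using absolutely_integrable_bilinear_continuous[OF h continuous_on_subset[OF contF] gabs(1)] that
    by auto
  let ?H = "\<lambda>x. h (f x) (G x) + h (F x) (g x)"
  have ai: "?H absolutely_integrable_on {x..y}" "?H integrable_on {x..y}" if "0 \<le> x" "y \<le> c" for x y
    using ai1 ai2 that by (auto intro: set_integral_add integrable_add)
  show ?thesis
  proof (rule is_primitiveI)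
    show "?H absolutely_integrable_on {0..c}" by (rule ai(1)) auto
    fix x assume "0 \<le> x" "x \<le> c"
    then have x: "x \<in> {0..c}" by simp
    \<comment> \<open>\<open>D\<close> is the defect of the product formula; the increments of
      \<open>M\<close> measure how much of it a short interval can contribute.\<close>
    define D where "D = (\<lambda>x. h (F x) (G x) - integral {0..x} ?H)"
    define m where "m = (\<lambda>x. norm (f x) + norm (g x))"
    define M where "M = (\<lambda>x. integral {0..x} m)"
    have m: "m integrable_on {u..v}" if "0 \<le> u" "v \<le> c" for u v
      unfolding m_def using fabs(1)[OF that] gabs(1)[OF that]
      by (intro integrable_add) (auto simp: absolutely_integrable_on_def)
    have "D x = D 0"
    proof (rule constant_if_small_increments[where M = M])
      show "0 \<le> x" using x by simp
      fix e :: real assume "e > 0"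
      have "uniformly_continuous_on {0..c} F" "uniformly_continuous_on {0..c} G"
        using contF contG by (auto intro: compact_uniformly_continuous)
      then obtain d1 d2 where "d1 > 0" "d2 > 0"
        and d1: "\<And>s t. s \<in> {0..c} \<Longrightarrow> t \<in> {0..c} \<Longrightarrow> dist t s < d1 \<Longrightarrow> dist (F t) (F s) < e / K"
        and d2: "\<And>s t. s \<in> {0..c} \<Longrightarrow> t \<in> {0..c} \<Longrightarrow> dist t s < d2 \<Longrightarrow> dist (G t) (G s) < e / K"
        unfolding uniformly_continuous_on_def
        by (metis \<open>e > 0\<close> \<open>K > 0\<close> divide_pos_pos)
      show "\<exists>d>0. \<forall>u v. 0 \<le> u \<and> u \<le> v \<and> v \<le> x \<and> v - u < d \<longrightarrow>
                  norm (D v - D u) \<le> e * (M v - M u)"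
      proof (intro exI[of _ "min d1 d2"] conjI allI impI)
        fix u v assume uv: "0 \<le> u \<and> u \<le> v \<and> v \<le> x \<and> v - u < min d1 d2"
        have uvc: "0 \<le> u" "u \<le> v" "v \<le> c" using uv x by auto
        have intH: "integral {0..u} ?H + integral {u..v} ?H = integral {0..v} ?H"
          using uvc by (simp add: Henstock_Kurzweil_Integration.integral_combine ai)
        have hf: "integral {u..v} (\<lambda>s. h (f s) (G v)) = h (F v - F u) (G v)"
          using integral_linear[OF fabs(2)[of u v] h.bounded_linear_left[of "G v"]] uvc
            is_primitive_diff[OF F] by (simp add: o_def)
        have hg: "integral {u..v} (\<lambda>s. h (F u) (g s)) = h (F u) (G v - G u)"
          using integral_linear[OF gabs(2)[of u v] h.bounded_linear_right[of "F u"]] uvc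
            is_primitive_diff[OF G] by (simp add: o_def)
        have if1: "(\<lambda>s. h (f s) (G v)) integrable_on {u..v}"
          using integrable_linear[OF fabs(2)[of u v] h.bounded_linear_left[of "G v"]] uvc
          by (simp add: o_def)
        have if2: "(\<lambda>s. h (F u) (g s)) integrable_on {u..v}"
          using integrable_linear[OF gabs(2)[of u v] h.bounded_linear_right[of "F u"]] uvc
          by (simp add: o_def)
        let ?E = "\<lambda>s. h (f s) (G v) + h (F u) (g s) - ?H s"
        have "D v - D u = h (F v - F u) (G v) + h (F u) (G v - G u) - integral {u..v} ?H"
          unfolding D_def using intH by (simp add: h.diff_left h.diff_right algebra_simps)
        also have "\<dots> = integral {u..v} ?E"
          using if1 if2 ai(2) ai1(2)[of u v] ai2(2)[of u v] uvc
          by (subst Henstock_Kurzweil_Integration.integral_diff) (auto simp: Henstock_Kurzweil_Integration.integral_add hf hg intro: integrable_add)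
        finally have *: "D v - D u = integral {u..v} ?E" .
        have "norm (integral {u..v} ?E) \<le> integral {u..v} (\<lambda>s. e * m s)"
        proof (rule integral_norm_bound_integral)
          show "?E integrable_on {u..v}"
            by (rule integrable_diff[OF integrable_add[OF if1 if2] ai(2)]) (use uvc in auto)
          show "(\<lambda>s. e * m s) integrable_on {u..v}"
            using m uvc integrable_on_cmult_left[of m "{u..v}" e] by simp
          fix s assume s: "s \<in> {u..v}"
          have "?E s = h (f s) (G v - G s) + h (F u - F s) (g s)"
            by (simp add: h.diff_left h.diff_right)
          also have "norm \<dots> \<le> norm (f s) * (e / K) * K + (e / K) * norm (g s) * K"
          proof (rule norm_triangle_le, rule add_mono; rule order_trans[OF K];
                 intro mult_right_mono mult_left_mono)
            show "norm (G v - G s) \<le> e / K"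
              using d2[of s v] s uv uvc by (auto simp: dist_norm)
            show "norm (F u - F s) \<le> e / K"
              using d1[of s u] s uv uvc by (auto simp: dist_norm)
          qed (use \<open>K > 0\<close> in auto)
          also have "\<dots> = e * m s"
            using \<open>K > 0\<close> by (simp add: m_def algebra_simps)
          finally show "norm (?E s) \<le> e * m s" .
        qed
        also have "\<dots> = e * integral {u..v} m"
          by simp
        also have "integral {u..v} m = M v - M u"
          unfolding M_def using Henstock_Kurzweil_Integration.integral_combine[of 0 u v m] m uvc by (simp add: algebra_simps)
        finally show "norm (D v - D u) \<le> e * (M v - M u)" using * by simp
      qed (use \<open>d1 > 0\<close> \<open>d2 > 0\<close> in auto)
    qed
    then show "h (F x) (G x) = h (F 0) (G 0) + integral {0..x} ?H"
      by (simp add: D_def diff_eq_eq)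
  qed
qed

lemmas is_primitive_mult = is_primitive_bilinear[OF bounded_bilinear_mult]
lemmas is_primitive_inner = is_primitive_bilinear[OF bounded_bilinear_inner]

text \<open>All integrals of \<open>f\<close> over subintervals vanish, so in the Henstock lemma the
  Riemann sums of \<open>norm (f x)\<close> themselves are small; hence \<open>norm (f x)\<close>
  has integral 0 and vanishes almost everywhere.\<close>

lemma is_primitive_zero_AE:
  assumes F: "is_primitive F f c" and zero: "\<And>x. x \<in> {0..c} \<Longrightarrow> F x = 0"
  shows "AE x in lebesgue. x \<in> {0..c} \<longrightarrow> f x = 0"
proof -
  have abs: "f absolutely_integrable_on {0..c}"
    using F by (rule is_primitive_absolutely_integrable)
  have K0: "integral K f = 0" if K: "K \<subseteq> {0..c}" "K = {u..v}" "K \<noteq> {}" for K u v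
    using is_primitive_diff[OF F, of u v] zero[of u] zero[of v] K by auto
  have "((\<lambda>x. norm (f x)) has_integral 0) (cbox 0 c)"
    unfolding has_integral
  proof (intro allI impI)
    fix e :: real assume "e > 0"
    have "f integrable_on cbox 0 c" using abs by (simp add: absolutely_integrable_on_def)
    then obtain \<gamma> where \<gamma>: "gauge \<gamma>" "\<And>p. \<lbrakk>p tagged_partial_division_of (cbox 0 c); \<gamma> fine p\<rbrakk> \<Longrightarrow>
             sum (\<lambda>(x,k). norm (measure lborel k *\<^sub>R f x - integral k f)) p < e"
      using Henstock_lemma[OF _ \<open>e > 0\<close>] by blast
    show "\<exists>\<gamma>. gauge \<gamma> \<and> (\<forall>\<D>. \<D> tagged_division_of cbox 0 c \<and> \<gamma> fine \<D> \<longrightarrow>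
            norm ((\<Sum>(x, k)\<in>\<D>. measure lborel k *\<^sub>R norm (f x)) - 0) < e)"
    proof (intro exI[of _ \<gamma>] conjI allI impI \<gamma>(1))
      fix \<D> assume D: "\<D> tagged_division_of cbox 0 c \<and> \<gamma> fine \<D>"
      have "(\<Sum>(x, k)\<in>\<D>. measure lborel k *\<^sub>R norm (f x)) = (\<Sum>(x, k)\<in>\<D>. norm (measure lborel k *\<^sub>R f x - integral k f))"
      proof (rule sum.cong[OF refl], clarify)
        fix x k assume xk: "(x, k) \<in> \<D>"
        have "x \<in> k" "k \<subseteq> cbox 0 c" "\<exists>u v. k = cbox u v"
          using D xk by (auto simp: tagged_division_of_def tagged_partial_division_of_def)
        then have "integral k f = 0" using K0 by auto
        then show "measure lborel k *\<^sub>R norm (f x) = norm (measure lborel k *\<^sub>R f x - integral k f)" by simp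
      qed
      also have "\<dots> < e"
        using \<gamma>(2) D by (auto simp: tagged_division_of_def)
      finally have "(\<Sum>(x, k)\<in>\<D>. measure lborel k *\<^sub>R norm (f x)) < e" .
      moreover have "0 \<le> (\<Sum>(x, k)\<in>\<D>. measure lborel k *\<^sub>R norm (f x))"
        by (intro sum_nonneg) auto
      ultimately show "norm ((\<Sum>(x, k)\<in>\<D>. measure lborel k *\<^sub>R norm (f x)) - 0) < e" by simp
    qed
  qed
  then have i0: "integral {0..c} (\<lambda>x. norm (f x)) = 0" by (simp add: integral_unique)
  have n: "(\<lambda>x. norm (f x)) absolutely_integrable_on {0..c}"
    using absolutely_integrable_norm[OF abs] by (simp add: o_def)
  then have int: "integrable lebesgue (\<lambda>x. indicator {0..c} x *\<^sub>R norm (f x))"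
    by (simp add: set_integrable_def)
  have "(\<integral>x. indicator {0..c} x *\<^sub>R norm (f x) \<partial>lebesgue) = 0"
    using set_lebesgue_integral_eq_integral(2)[OF n] i0 by (simp add: set_lebesgue_integral_def)
  then have "AE x in lebesgue. indicator {0..c} x *\<^sub>R norm (f x) = 0"
    using integral_nonneg_eq_0_iff_AE[OF int] by simp
  then show ?thesis
    by eventually_elim (auto split: split_indicator_asm)
qed

lemma is_primitive_zero_continuous:
  assumes F: "is_primitive F f c" and f: "continuous_on {0..c} f" and "0 < c"
    and zero: "\<And>x. x \<in> {0..c} \<Longrightarrow> F x = 0" and x: "x \<in> {0..c}"
  shows "f x = 0"
proof -
  have "(F has_vector_derivative f x) (at x within {0..c})"
    using is_primitive_has_vector_derivative[OF F f x] .
  moreover have "(F has_vector_derivative 0) (at x within {0..c})"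
    by (rule has_vector_derivative_transform[OF x _ has_vector_derivative_const[of 0]]) (use zero in auto)
  ultimately show ?thesis
    using vector_derivative_unique_within_closed_interval[of 0 c x F] \<open>0 < c\<close> x by auto
qed

subsection \<open>Linear equations with integrable coefficients\<close>

text \<open>A nonintegrable function has integral 0 by convention, which settles the second
  case.\<close>

lemma integral_nonneg_total:
  fixes f :: "real \<Rightarrow> real"
  assumes "\<And>x. x \<in> S \<Longrightarrow> 0 \<le> f x"
  shows "0 \<le> integral S f"
  using assms
  by (cases "f integrable_on S")
    (auto intro: Henstock_Kurzweil_Integration.integral_nonneg simp: not_integrable_integral)

text \<open>These are the iterated integrals that arise when an integral inequality or a Picard
  operator is applied \<open>n\<close> times.\<close>

lemma is_primitive_power:
  fixes G g :: "real \<Rightarrow> real"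
  assumes G: "is_primitive G g c" and "G 0 = 0"
  shows "is_primitive (\<lambda>x. G x ^ Suc n / fact (Suc n)) (\<lambda>x. g x * (G x ^ n / fact n)) c"
proof (induction n)
  case 0
  then show ?case using G by simp
next
  case (Suc n)
  \<comment> \<open>The two terms of the product rule are
    \<open>g * G ^ Suc n / fact (Suc n)\<close> and \<open>Suc n\<close> times the same expression,
    hence the factor \<open>1 / real (Suc (Suc n))\<close>.\<close>
  have "is_primitive (\<lambda>x. G x * (G x ^ Suc n / fact (Suc n)) * (1 / real (Suc (Suc n))))
     (\<lambda>x. (g x * (G x ^ Suc n / fact (Suc n)) + G x * (g x * (G x ^ n / fact n)))
            * (1 / real (Suc (Suc n)))) c"
    by (rule is_primitive_linear[OF is_primitive_mult[OF G Suc]]) (rule bounded_linear_mult_left)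
  moreover have "G x * (G x ^ Suc n / fact (Suc n)) * (1 / real (Suc (Suc n)))
      = G x ^ Suc (Suc n) / fact (Suc (Suc n))" for x
    by (simp add: field_simps)
  moreover have "(g x * (G x ^ Suc n / fact (Suc n)) + G x * (g x * (G x ^ n / fact n)))
            * (1 / real (Suc (Suc n))) = g x * (G x ^ Suc n / fact (Suc n))" for x
  proof -
    have "(fact (Suc n) :: real) = real (Suc n) * fact n" by simp
    moreover have "(fact n :: real) \<noteq> 0" by simp
    ultimately show ?thesis by (simp add: divide_simps del: fact_Suc) (simp add: algebra_simps)
  qed
  ultimately show ?case by (simp only:)
qed

text \<open>Inserting the inequality into itself \<open>n\<close> times gives a partial sum of the
  exponential series plus the remainder \<open>B * (G x ^ n / fact n)\<close>, which tends to 0. The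
  argument works for a coefficient that is merely integrable.\<close>

lemma gronwall_L1:
  fixes N g :: "real \<Rightarrow> real"
  assumes cont: "continuous_on {0..c} N" and g: "g absolutely_integrable_on {0..c}"
    and g0: "\<And>x. x \<in> {0..c} \<Longrightarrow> 0 \<le> g x" and "0 \<le> N0"
    and le: "\<And>x. x \<in> {0..c} \<Longrightarrow> N x \<le> N0 + integral {0..x} (\<lambda>t. g t * N t)"
    and x: "x \<in> {0..c}"
  shows "N x \<le> N0 * exp (integral {0..x} g)"
proof -
  define G where "G = (\<lambda>x. integral {0..x} g)"
  have G: "is_primitive G g c" using is_primitive_integral[OF g, of 0] by (simp add: G_def)
  have G0: "G 0 = 0" by (simp add: G_def)
  note pow = is_primitive_power[OF G G0]
  obtain B where "B \<ge> 0" and B: "\<And>x. x \<in> {0..c} \<Longrightarrow> N x \<le> B"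
  proof -
    have "bounded (N ` {0..c})"
      using cont compact_continuous_image compact_imp_bounded by blast
    then obtain b where "\<And>x. x \<in> {0..c} \<Longrightarrow> norm (N x) \<le> b"
      unfolding bounded_iff by (meson imageI)
    then show ?thesis
      by (intro that[of "max 0 b"]) (auto simp: le_max_iff_disj abs_le_iff)
  qed
  have "\<forall>x\<in>{0..c}. N x \<le> N0 * (\<Sum>j<n. G x ^ j / fact j) + B * (G x ^ n / fact n)" for n
  proof (induction n)
    case 0
    then show ?case using B by simp
  next
    case (Suc n)
    show ?case
    proof
      fix x assume x: "x \<in> {0..c}"
      let ?R = "\<lambda>t. N0 * (\<Sum>j<n. G t ^ j / fact j) + B * (G t ^ n / fact n)"
      have int: "((\<lambda>t. g t * (G t ^ j / fact j)) has_integral G x ^ Suc j / fact (Suc j)) {0..x}" for j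
        using is_primitive_subinterval(2)[OF pow[of j], of 0 x] is_primitive_eq[OF pow[of j], of x] x G0
        by (auto simp: has_integral_iff)
      have "((\<lambda>t. N0 * (\<Sum>j<n. g t * (G t ^ j / fact j)) + B * (g t * (G t ^ n / fact n)))
          has_integral N0 * (\<Sum>j<n. G x ^ Suc j / fact (Suc j)) + B * (G x ^ Suc n / fact (Suc n))) {0..x}"
        by (intro has_integral_add has_integral_mult_right has_integral_sum int finite_lessThan)
      then have R: "((\<lambda>t. g t * ?R t)
          has_integral N0 * (\<Sum>j<n. G x ^ Suc j / fact (Suc j)) + B * (G x ^ Suc n / fact (Suc n))) {0..x}"
        by (rule has_integral_eq[rotated]) (simp add: algebra_simps sum_distrib_left)
      have "(\<lambda>t. N t * g t) integrable_on {0..c}"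
        by (rule absolutely_integrable_bilinear_continuous(2)[OF bounded_bilinear_mult cont g])
      then have "(\<lambda>t. g t * N t) integrable_on {0..x}"
        using x by (auto simp: mult.commute intro: integrable_on_subinterval)
      then have "integral {0..x} (\<lambda>t. g t * N t)
          \<le> N0 * (\<Sum>j<n. G x ^ Suc j / fact (Suc j)) + B * (G x ^ Suc n / fact (Suc n))"
        using Suc x g0 by (intro has_integral_le[OF integrable_integral R] mult_left_mono) auto
      then have "N x \<le> N0 + N0 * (\<Sum>j<n. G x ^ Suc j / fact (Suc j)) + B * (G x ^ Suc n / fact (Suc n))"
        using le[OF x] by linarith
      also have "N0 + N0 * (\<Sum>j<n. G x ^ Suc j / fact (Suc j)) = N0 * (\<Sum>j<Suc n. G x ^ j / fact j)"
        by (subst sum.lessThan_Suc_shift) (simp add: algebra_simps)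
      finally show "N x \<le> N0 * (\<Sum>j<Suc n. G x ^ j / fact j) + B * (G x ^ Suc n / fact (Suc n))" .
    qed
  qed
  then have "N x \<le> N0 * (\<Sum>j<n. G x ^ j / fact j) + B * (G x ^ n / fact n)" for n
    using x by blast
  moreover have "(\<lambda>n. N0 * (\<Sum>j<n. G x ^ j / fact j) + B * (G x ^ n / fact n)) \<longlonglongrightarrow>
      N0 * exp (G x) + B * 0"
  proof (intro tendsto_intros)
    have s: "(\<lambda>j. G x ^ j / fact j) sums exp (G x)"
      using exp_converges[of "G x"] by (simp add: field_simps)
    then show "(\<lambda>n. \<Sum>j<n. G x ^ j / fact j) \<longlonglongrightarrow> exp (G x)"
      by (simp add: sums_def)
    show "(\<lambda>n. G x ^ n / fact n) \<longlonglongrightarrow> 0"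
      using s summable_LIMSEQ_zero sums_summable by blast
  qed
  ultimately have "N x \<le> N0 * exp (G x) + B * 0"
    by (meson LIMSEQ_le_const)
  then show ?thesis by (simp add: G_def)
qed

text \<open>Picard iteration for \<open>y = a + T y\<close>, where \<open>a\<close> is the solution
  for \<open>p = 0\<close> and \<open>T\<close> integrates \<open>p * y\<close> twice. Each
  application of \<open>T\<close> turns a bound by \<open>L ^ n / fact n\<close> into one by the
  next term of the exponential series, so the iteration converges uniformly on the whole
  interval.\<close>

lemma linear_ode_exists:
  fixes p :: "real \<Rightarrow> complex"
  assumes "0 < c" and p: "p absolutely_integrable_on {0..c}"
  shows "\<exists>y y'. y 0 = \<alpha> \<and> y' 0 = \<beta> \<and> is_primitive y y' c \<and> is_primitive y' (\<lambda>x. p x * y x) c"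
proof -
  define T where "T = (\<lambda>y x. integral {0..x} (\<lambda>s. integral {0..s} (\<lambda>t. p t * y t)))"
  \<comment> \<open>The factor \<open>c\<close> pays for the outer of the two integrations in
    \<open>T\<close>.\<close>
  define L where "L = (\<lambda>x. integral {0..x} (\<lambda>t. c * norm (p t)))"
  have npai: "(\<lambda>t. c * norm (p t)) absolutely_integrable_on {0..c}"
    using absolutely_integrable_norm[OF p] by (auto simp: o_def)
  have L: "is_primitive L (\<lambda>t. c * norm (p t)) c"
    using is_primitive_integral[OF npai, of 0] by (simp add: L_def)
  have L0: "L 0 = 0" by (simp add: L_def)
  note Lpow = is_primitive_power[OF L L0]
  have Lnn: "0 \<le> L x" for x
    unfolding L_def using \<open>0 < c\<close> by (intro integral_nonneg_total) auto
  have Lmono: "L x \<le> L y" if "0 \<le> x" "x \<le> y" "y \<le> c" for x y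
  proof -
    have "0 \<le> integral {x..y} (\<lambda>t. c * norm (p t))"
      using \<open>0 < c\<close> by (intro integral_nonneg_total) auto
    then show ?thesis using is_primitive_diff[OF L that] by simp
  qed
  have py: "(\<lambda>t. p t * y t) absolutely_integrable_on {0..c}"
    if "continuous_on {0..c} y" for y
    using absolutely_integrable_bilinear_continuous(1)[OF bounded_bilinear_mult that p]
    by (simp add: mult.commute)
  have inner_prim: "is_primitive (\<lambda>s. k + integral {0..s} (\<lambda>t. p t * y t)) (\<lambda>t. p t * y t) c"
    if "continuous_on {0..c} y" for y k
    using is_primitive_integral[OF py[OF that]] .
  have inner_cont: "continuous_on {0..c} (\<lambda>s. integral {0..s} (\<lambda>t. p t * y t))"
    if "continuous_on {0..c} y" for y
    using is_primitive_continuous_on[OF inner_prim[OF that, of 0]] by simp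
  have Tprim: "is_primitive (T y) (\<lambda>s. integral {0..s} (\<lambda>t. p t * y t)) c"
    if "continuous_on {0..c} y" for y
    using is_primitive_integral[OF absolutely_integrable_continuous_real[OF inner_cont[OF that]], of 0]
    by (simp add: T_def)
  have Tcont: "continuous_on {0..c} (T y)" if "continuous_on {0..c} y" for y
    using is_primitive_continuous_on[OF Tprim[OF that]] .
  have Tbound: "norm (T y x) \<le> M * (L x ^ Suc n / fact (Suc n))"
    if y: "continuous_on {0..c} y" and bnd: "\<And>t. t \<in> {0..c} \<Longrightarrow> norm (y t) \<le> M * (L t ^ n / fact n)"
      and "M \<ge> 0" and x: "x \<in> {0..c}" for y M n x
  proof -
    \<comment> \<open>Monotonicity of \<open>L\<close> moves the bound from \<open>s\<close> to
      \<open>x\<close>, so that the outer integration costs only the length of the interval.\<close>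
    have *: "norm (integral {0..s} (\<lambda>t. p t * y t)) \<le> M / c * (L x ^ Suc n / fact (Suc n))"
      if s: "s \<in> {0..x}" for s
    proof -
      have sc: "s \<le> c" "0 \<le> s" using s x by auto
      have int: "((\<lambda>t. M / c * (c * norm (p t) * (L t ^ n / fact n)))
            has_integral M / c * (L s ^ Suc n / fact (Suc n))) {0..s}"
        using is_primitive_subinterval(2)[OF Lpow[of n], of 0 s] is_primitive_eq[OF Lpow[of n], of s] sc L0
        by (intro has_integral_mult_right) (auto simp: has_integral_iff)
      have "norm (integral {0..s} (\<lambda>t. p t * y t)) \<le> integral {0..s} (\<lambda>t. M / c * (c * norm (p t) * (L t ^ n / fact n)))"
      proof (rule integral_norm_bound_integral)
        show "(\<lambda>t. p t * y t) integrable_on {0..s}"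
          using is_primitive_subinterval(2)[OF inner_prim[OF y], of 0 s] sc by simp
        show "norm (p t * y t) \<le> M / c * (c * norm (p t) * (L t ^ n / fact n))" if "t \<in> {0..s}" for t
        proof -
          have "norm (p t) * norm (y t) \<le> norm (p t) * (M * (L t ^ n / fact n))"
            using that sc by (intro mult_left_mono bnd) auto
          also have "\<dots> = M / c * (c * norm (p t) * (L t ^ n / fact n))"
            using \<open>0 < c\<close> by simp
          finally show ?thesis by (simp add: norm_mult)
        qed
      qed (use int in blast)
      also have "\<dots> = M / c * (L s ^ Suc n / fact (Suc n))"
        using int by (rule integral_unique)
      also have "\<dots> \<le> M / c * (L x ^ Suc n / fact (Suc n))"
        using s sc x Lmono[of s x] Lnn[of s] \<open>0 < c\<close> \<open>M \<ge> 0\<close>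
        by (intro mult_left_mono divide_right_mono power_mono) auto
      finally show ?thesis .
    qed
    have "norm (T y x) \<le> M / c * (L x ^ Suc n / fact (Suc n)) * (x - 0)"
      unfolding T_def using x continuous_on_subset[OF inner_cont[OF y]] *
      by (intro integral_bound) auto
    also have "\<dots> \<le> M / c * (L x ^ Suc n / fact (Suc n)) * c"
      using x \<open>0 < c\<close> \<open>M \<ge> 0\<close> Lnn[of x] by (intro mult_left_mono mult_nonneg_nonneg) auto
    finally show ?thesis using \<open>0 < c\<close> by simp
  qed
  have Tdiff: "T (\<lambda>t. y t - w t) x = T y x - T w x"
    if "continuous_on {0..c} y" "continuous_on {0..c} w" "x \<in> {0..c}" for y w x
  proof -
    have "integral {0..s} (\<lambda>t. p t * (y t - w t)) = integral {0..s} (\<lambda>t. p t * y t) - integral {0..s} (\<lambda>t. p t * w t)"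
      if "s \<in> {0..x}" for s
      using is_primitive_subinterval(2)[OF inner_prim[OF \<open>continuous_on {0..c} y\<close>], of 0 s]
        is_primitive_subinterval(2)[OF inner_prim[OF \<open>continuous_on {0..c} w\<close>], of 0 s] that \<open>x \<in> {0..c}\<close>
      by (simp add: right_diff_distrib Henstock_Kurzweil_Integration.integral_diff)
    then have "T (\<lambda>t. y t - w t) x = integral {0..x}
        (\<lambda>s. integral {0..s} (\<lambda>t. p t * y t) - integral {0..s} (\<lambda>t. p t * w t))"
      unfolding T_def by (intro integral_cong) auto
    also have "\<dots> = T y x - T w x"
      unfolding T_def using is_primitive_subinterval(2)[OF Tprim[OF that(1)], of 0 x]
        is_primitive_subinterval(2)[OF Tprim[OF that(2)], of 0 x] that(3)
      by (intro Henstock_Kurzweil_Integration.integral_diff) auto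
    finally show ?thesis .
  qed
  define a where "a = (\<lambda>x. \<alpha> + \<beta> * complex_of_real x)"
  have acont: "continuous_on {0..c} a" unfolding a_def by (intro continuous_intros)
  define S where "S = rec_nat (\<lambda>x. 0) (\<lambda>_ y x. a x + T y x)"
  have S0: "S 0 = (\<lambda>x. 0)" and SSuc: "S (Suc n) = (\<lambda>x. a x + T (S n) x)" for n
    by (simp_all add: S_def)
  have Scont: "continuous_on {0..c} (S n)" for n
    by (induction n) (simp_all add: S0 SSuc continuous_on_add acont Tcont)
  define M where "M = norm \<alpha> + norm \<beta> * c"
  have "M \<ge> 0" using \<open>0 < c\<close> by (simp add: M_def)
  have T0: "T (\<lambda>x. 0) x = 0" for x by (simp add: T_def)
  have Sdiff: "\<forall>x\<in>{0..c}. norm (S (Suc n) x - S n x) \<le> M * (L x ^ n / fact n)" for n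
  proof (induction n)
    case 0
    show ?case
    proof
      fix x assume "x \<in> {0..c}"
      then have "norm (a x) \<le> M"
        unfolding a_def M_def by (intro norm_triangle_le add_left_mono) (auto simp: norm_mult intro: mult_left_mono)
      then show "norm (S (Suc 0) x - S 0 x) \<le> M * (L x ^ 0 / fact 0)"
        by (simp add: S0 SSuc T0)
    qed
  next
    case (Suc n)
    show ?case
    proof
      fix x assume x: "x \<in> {0..c}"
      have "S (Suc (Suc n)) x - S (Suc n) x = T (\<lambda>t. S (Suc n) t - S n t) x"
        unfolding Tdiff[OF Scont Scont x] by (simp add: SSuc)
      also have "norm \<dots> \<le> M * (L x ^ Suc n / fact (Suc n))"
        using Suc \<open>M \<ge> 0\<close> x by (intro Tbound continuous_on_diff Scont) auto
      finally show "norm (S (Suc (Suc n)) x - S (Suc n) x) \<le> M * (L x ^ Suc n / fact (Suc n))" .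
    qed
  qed
  have unif: "uniform_limit {0..c} (\<lambda>n x. \<Sum>i<n. S (Suc i) x - S i x) (\<lambda>x. \<Sum>i. S (Suc i) x - S i x) sequentially"
  proof (rule Weierstrass_m_test)
    fix n x assume x: "x \<in> {0..c}"
    have "norm (S (Suc n) x - S n x) \<le> M * (L x ^ n / fact n)" using Sdiff x by blast
    also have "\<dots> \<le> M * (L c ^ n / fact n)"
      using x Lmono[of x c] Lnn \<open>M \<ge> 0\<close> by (intro mult_left_mono divide_right_mono power_mono) auto
    finally show "norm (S (Suc n) x - S n x) \<le> M * (L c ^ n / fact n)" .
  next
    show "summable (\<lambda>n. M * (L c ^ n / fact n))"
      using summable_exp[of "L c"] by (intro summable_mult) (simp add: field_simps)
  qed
  define y where "y = (\<lambda>x. \<Sum>i. S (Suc i) x - S i x)"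
  have tele: "(\<Sum>i<n. S (Suc i) x - S i x) = S n x" for n x
    using sum_lessThan_telescope[of "\<lambda>i. S i x" n] by (simp add: S0)
  have lim: "uniform_limit {0..c} S y sequentially"
    using unif unfolding y_def tele .
  have ycont: "continuous_on {0..c} y"
    by (rule uniform_limit_theorem[OF _ lim]) (auto simp: Scont)
  have y_eq: "y x = a x + T y x" if x: "x \<in> {0..c}" for x
  proof (rule LIMSEQ_unique)
    show "(\<lambda>n. S (Suc n) x) \<longlonglongrightarrow> y x"
      using tendsto_uniform_limitI[OF lim x] by (rule LIMSEQ_Suc)
    \<comment> \<open>\<open>Tbound\<close> with \<open>n = 0\<close> makes \<open>T\<close>
      Lipschitz for the supremum norm, so it passes to the uniform limit.\<close>
    have "(\<lambda>n. T (S n) x) \<longlonglongrightarrow> T y x"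
    proof (rule LIMSEQ_I)
      fix e :: real assume "e > 0"
      define d where "d = e / (L x + 1)"
      have Lx: "L x + 1 > 0" using Lnn[of x] by simp
      have "d > 0" using \<open>e > 0\<close> Lx by (simp add: d_def)
      then obtain n0 where n0: "\<And>n t. n \<ge> n0 \<Longrightarrow> t \<in> {0..c} \<Longrightarrow> dist (S n t) (y t) < d"
        using lim unfolding uniform_limit_iff eventually_sequentially by meson
      show "\<exists>n0. \<forall>n\<ge>n0. norm (T (S n) x - T y x) < e"
      proof (intro exI allI impI)
        fix n assume "n \<ge> n0"
        have "norm (T (\<lambda>t. S n t - y t) x) \<le> d * (L x ^ Suc 0 / fact (Suc 0))"
          using n0[OF \<open>n \<ge> n0\<close>] \<open>d > 0\<close> x less_imp_le
          by (intro Tbound continuous_on_diff Scont ycont) (auto simp: dist_norm)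
        also have "\<dots> < d * (L x + 1)" using \<open>d > 0\<close> by simp
        also have "\<dots> = e" using Lx by (simp add: d_def)
        finally show "norm (T (S n) x - T y x) < e"
          by (simp add: Tdiff[OF Scont ycont x])
      qed
    qed
    then show "(\<lambda>n. S (Suc n) x) \<longlonglongrightarrow> a x + T y x"
      unfolding SSuc by (intro tendsto_intros)
  qed
  define y' where "y' = (\<lambda>x. \<beta> + integral {0..x} (\<lambda>t. p t * y t))"
  have "is_primitive y' (\<lambda>x. p x * y x) c"
    unfolding y'_def by (rule inner_prim[OF ycont])
  moreover have "is_primitive y y' c"
  proof -
    have "is_primitive a (\<lambda>x. \<beta>) c"
      unfolding a_def by (rule is_primitiveI_C1) (auto intro!: derivative_eq_intros)
    from is_primitive_add[OF this Tprim[OF ycont]]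
    show ?thesis
      by (rule is_primitive_cong) (auto simp: y_eq y'_def)
  qed
  moreover have "y 0 = \<alpha>" "y' 0 = \<beta>"
    using y_eq[of 0] \<open>0 < c\<close> by (auto simp: a_def T_def y'_def)
  ultimately show ?thesis by blast
qed

subsection \<open>Solutions of the Schroedinger equation\<close>

text \<open>The equation as a first-order system in integrated form: \<open>y'\<close> is carried
  along as a continuous function, while the second derivative need exist only almost
  everywhere.\<close>

definition ode_sol ::
    "(real \<Rightarrow> real) \<Rightarrow> complex \<Rightarrow> real \<Rightarrow> (real \<Rightarrow> complex) \<Rightarrow> (real \<Rightarrow> complex) \<Rightarrow> bool" where
  "ode_sol q z c y y' \<longleftrightarrow>
     is_primitive y y' c \<and> is_primitive y' (\<lambda>x. (of_real (q x) - z) * y x) c"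

lemma ode_sol_continuous:
  assumes "ode_sol q z c y y'"
  shows "continuous_on {0..c} y" "continuous_on {0..c} y'"
  using assms by (auto simp: ode_sol_def intro: is_primitive_continuous_on)

lemma ode_sol_exists:
  assumes "0 < c" "q absolutely_integrable_on {0..c}"
  shows "\<exists>y y'. y 0 = \<alpha> \<and> y' 0 = \<beta> \<and> ode_sol q z c y y'"
proof -
  have "(\<lambda>x. complex_of_real (q x)) absolutely_integrable_on {0..c}"
    using absolutely_integrable_linear[OF assms(2) bounded_linear_of_real] by (simp add: o_def)
  then have "(\<lambda>x. complex_of_real (q x) - z) absolutely_integrable_on {0..c}"
    by (intro set_integral_diff) auto
  from linear_ode_exists[OF assms(1) this] show ?thesis
    unfolding ode_sol_def by blast
qed

text \<open>The terms with the potential cancel and only the difference of the spectral parameters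
  is left. The case \<open>z \<noteq> w\<close> serves the variation of constants.\<close>

lemma is_primitive_wronskian:
  assumes y: "ode_sol q z c y y'" and v: "ode_sol q w c v v'"
  shows "is_primitive (\<lambda>x. y x * v' x - y' x * v x) (\<lambda>x. (z - w) * (y x * v x)) c"
proof -
  have "is_primitive (\<lambda>x. y x * v' x - y' x * v x)
     (\<lambda>x. (y' x * v' x + y x * ((of_real (q x) - w) * v x))
        - ((of_real (q x) - z) * y x * v x + y' x * v' x)) c"
    using y v unfolding ode_sol_def by (intro is_primitive_minus is_primitive_mult) auto
  then show ?thesis
    by (rule is_primitive_cong) (auto simp: algebra_simps)
qed

lemma wronskian_const:
  assumes "ode_sol q z c y y'" "ode_sol q z c v v'" "x \<in> {0..c}"
  shows "y x * v' x - y' x * v x = y 0 * v' 0 - y' 0 * v 0"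
  using is_primitive_eq[OF is_primitive_wronskian[OF assms(1,2)], of x] assms(3) by simp

text \<open>Gronwall for \<open>norm (y x) + norm (y' x)\<close>. The bound is crude in
  \<open>z\<close> but uniform on bounded sets, which is what differentiation in \<open>z\<close>
  uses.\<close>

lemma ode_sol_bound:
  assumes y: "ode_sol q z c y y'" and q: "q absolutely_integrable_on {0..c}"
    and z: "norm z \<le> R" and x: "x \<in> {0..c}"
  shows "norm (y x) \<le> (norm (y 0) + norm (y' 0)) * exp (integral {0..c} (\<lambda>t. 1 + R + \<bar>q t\<bar>))"
proof -
  define g where "g = (\<lambda>t. 1 + R + \<bar>q t\<bar>)"
  define N where "N = (\<lambda>x. norm (y x) + norm (y' x))"
  have "R \<ge> 0" using z norm_ge_zero[of z] by linarith
  have absq: "(\<lambda>t. \<bar>q t\<bar>) absolutely_integrable_on {0..c}"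
    using absolutely_integrable_norm[OF q] by (simp add: o_def)
  have g: "g absolutely_integrable_on {0..c}"
    unfolding g_def by (intro set_integral_add absq) auto
  have yc: "continuous_on {0..c} y" "continuous_on {0..c} y'"
    using ode_sol_continuous[OF y] by auto
  have Nc: "continuous_on {0..c} N"
    unfolding N_def by (intro continuous_intros yc)
  have py: "is_primitive y y' c" and py': "is_primitive y' (\<lambda>x. (of_real (q x) - z) * y x) c"
    using y by (auto simp: ode_sol_def)
  have "N x \<le> (norm (y 0) + norm (y' 0)) * exp (integral {0..x} g)"
  proof (rule gronwall_L1[OF Nc g])
    show "0 \<le> g x" for x using \<open>R \<ge> 0\<close> by (simp add: g_def)
    fix x assume x: "x \<in> {0..c}"
    have gN: "(\<lambda>t. g t * N t) integrable_on {0..x}"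
      using absolutely_integrable_bilinear_continuous(2)[OF bounded_bilinear_mult Nc g] x
      by (auto simp: mult.commute intro: integrable_on_subinterval)
    have i1: "y' integrable_on {0..x}" "(\<lambda>x. (of_real (q x) - z) * y x) integrable_on {0..x}"
      using is_primitive_subinterval(2)[OF py, of 0 x] is_primitive_subinterval(2)[OF py', of 0 x] x by auto
    have n1: "(\<lambda>t. norm (y' t)) integrable_on {0..x}" "(\<lambda>t. norm ((of_real (q t) - z) * y t)) integrable_on {0..x}"
      using is_primitive_subinterval(1)[OF py, of 0 x] is_primitive_subinterval(1)[OF py', of 0 x] x
      by (auto simp: absolutely_integrable_on_def)
    have "norm (y x) \<le> norm (y 0) + integral {0..x} (\<lambda>t. norm (y' t))"
      using is_primitive_eq[OF py, of x] x integral_norm_bound_integral[OF i1(1) n1(1)]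
      by (metis (no_types, lifting) atLeastAtMost_iff norm_triangle_le add_left_mono order_refl)
    moreover have "norm (y' x) \<le> norm (y' 0) + integral {0..x} (\<lambda>t. norm ((of_real (q t) - z) * y t))"
      using is_primitive_eq[OF py', of x] x integral_norm_bound_integral[OF i1(2) n1(2)]
      by (metis (no_types, lifting) atLeastAtMost_iff norm_triangle_le add_left_mono order_refl)
    moreover have "integral {0..x} (\<lambda>t. norm (y' t)) + integral {0..x} (\<lambda>t. norm ((of_real (q t) - z) * y t))
      = integral {0..x} (\<lambda>t. norm (y' t) + norm ((of_real (q t) - z) * y t))"
      using n1 by (simp add: Henstock_Kurzweil_Integration.integral_add)
    moreover have "\<dots> \<le> integral {0..x} (\<lambda>t. g t * N t)"
    proof (rule integral_le)
      show "(\<lambda>t. norm (y' t) + norm ((of_real (q t) - z) * y t)) integrable_on {0..x}"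
        using n1 by (rule integrable_add)
      fix t
      have "norm (of_real (q t) - z) \<le> \<bar>q t\<bar> + R"
        using norm_triangle_ineq4[of "of_real (q t)" z] z by simp
      then have "norm (of_real (q t) - z) * norm (y t) \<le> g t * norm (y t)"
        by (intro mult_right_mono) (auto simp: g_def)
      moreover have "1 * norm (y' t) \<le> g t * norm (y' t)"
        using \<open>R \<ge> 0\<close> by (intro mult_right_mono) (auto simp: g_def)
      ultimately show "norm (y' t) + norm ((of_real (q t) - z) * y t) \<le> g t * N t"
        unfolding N_def norm_mult distrib_left by linarith
    qed (rule gN)
    ultimately show "N x \<le> norm (y 0) + norm (y' 0) + integral {0..x} (\<lambda>t. g t * N t)"
      by (simp add: N_def)
  qed (use x in auto)
  also have "\<dots> \<le> (norm (y 0) + norm (y' 0)) * exp (integral {0..c} g)"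
  proof -
    have "integral {0..x} g \<le> integral {0..c} g"
      using g x \<open>R \<ge> 0\<close> by (intro integral_subset_le) (auto simp: g_def absolutely_integrable_on_def intro: integrable_on_subinterval)
    then show ?thesis by (intro mult_left_mono) auto
  qed
  finally show ?thesis
    unfolding N_def g_def using norm_ge_zero[of "y' x"] by linarith
qed

text \<open>Factorisation of the free equation:
  \<open>(y' + \<sigma> y)' = \<sigma> (y' + \<sigma> y) + q y\<close>, so the integrating factor
  \<open>exp (- \<sigma> * x)\<close> leaves only the term with the potential.\<close>

lemma is_primitive_first_order:
  assumes y: "ode_sol q z c y y'" and \<sigma>: "\<sigma>\<^sup>2 = - z"
  shows "is_primitive (\<lambda>x. exp (- \<sigma> * of_real x) * (y' x + \<sigma> * y x))
           (\<lambda>x. exp (- \<sigma> * of_real x) * (of_real (q x) * y x)) c"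
proof -
  have e: "is_primitive (\<lambda>x. exp (- \<sigma> * of_real x)) (\<lambda>x. - \<sigma> * exp (- \<sigma> * of_real x)) c"
    by (rule is_primitiveI_C1) (auto intro!: derivative_eq_intros continuous_intros has_vector_derivative_real_field)
  have "is_primitive (\<lambda>x. y' x + \<sigma> * y x) (\<lambda>x. (of_real (q x) - z) * y x + \<sigma> * y' x) c"
    using y unfolding ode_sol_def
    by (elim conjE) (rule is_primitive_add[OF _ is_primitive_linear[OF _ bounded_linear_mult_right]])
  from is_primitive_mult[OF e this] show ?thesis
  proof (rule is_primitive_cong)
    have "z = - (\<sigma> * \<sigma>)" using \<sigma> by (simp add: power2_eq_square)
    then have "exp (- \<sigma> * of_real x) * (of_real (q x) * y x) =
      - \<sigma> * exp (- \<sigma> * of_real x) * (y' x + \<sigma> * y x) +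
      exp (- \<sigma> * of_real x) * ((of_real (q x) - z) * y x + \<sigma> * y' x)" for x
      by (simp add: algebra_simps)
    then show "AE x in lebesgue. x \<in> {0..c} \<longrightarrow> exp (- \<sigma> * of_real x) * (of_real (q x) * y x) =
      - \<sigma> * exp (- \<sigma> * of_real x) * (y' x + \<sigma> * y x) +
      exp (- \<sigma> * of_real x) * ((of_real (q x) - z) * y x + \<sigma> * y' x)"
      by simp
  qed simp
qed

lemma ode_sol_first_order_bound:
  assumes y: "ode_sol q z c y y'" and \<sigma>: "\<sigma>\<^sup>2 = - z" and x: "x \<in> {0..c}"
    and g: "g integrable_on {0..x}"
    and le: "\<And>t. t \<in> {0..x} \<Longrightarrow> exp (- Re \<sigma> * t) * (\<bar>q t\<bar> * norm (y t)) \<le> g t"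
  shows "exp (- Re \<sigma> * x) * norm (y' x + \<sigma> * y x) \<le> norm (y' 0 + \<sigma> * y 0) + integral {0..x} g"
proof -
  note P = is_primitive_first_order[OF y \<sigma>]
  let ?I = "integral {0..x} (\<lambda>x. exp (- \<sigma> * of_real x) * (of_real (q x) * y x))"
  have eq: "exp (- \<sigma> * of_real x) * (y' x + \<sigma> * y x) = (y' 0 + \<sigma> * y 0) + ?I"
    using is_primitive_eq[OF P, of x] x by simp
  have "exp (- Re \<sigma> * x) * norm (y' x + \<sigma> * y x) = norm (exp (- \<sigma> * of_real x) * (y' x + \<sigma> * y x))"
    by (simp add: norm_mult)
  also have "\<dots> \<le> norm (y' 0 + \<sigma> * y 0) + norm ?I"
    unfolding eq by (rule norm_triangle_ineq)
  also have "norm ?I \<le> integral {0..x} g"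
    using is_primitive_subinterval(2)[OF P, of 0 x] x le
    by (intro integral_norm_bound_integral g) (auto simp: norm_mult)
  finally show ?thesis by simp
qed

text \<open>The first-order equations for \<open>\<sigma>\<close> and \<open>- \<sigma>\<close> are
  treated together: with the weight \<open>exp (- \<bar>Re \<sigma>\<bar> * x)\<close>, the larger
  of the two norms satisfies a Gronwall inequality whose coefficient \<open>\<bar>q t\<bar>\<close>
  is free of \<open>\<sigma>\<close>. The division by \<open>norm \<sigma>\<close> provides the
  extra decay of \<open>\<phi>\<close>.\<close>

lemma ode_sol_exponential_bound:
  assumes y: "ode_sol q z c y y'" and q: "q absolutely_integrable_on {0..c}"
    and \<sigma>: "\<sigma>\<^sup>2 = - z" "1 \<le> norm \<sigma>" and x: "x \<in> {0..c}"
  shows "norm (y x) \<le> (norm (y' 0) / norm \<sigma> + norm (y 0)) * exp (integral {0..c} (\<lambda>t. \<bar>q t\<bar>)) * exp (\<bar>Re \<sigma>\<bar> * x)"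
proof -
  define \<mu> where "\<mu> = \<bar>Re \<sigma>\<bar>"
  define N where "N = (\<lambda>x. exp (- \<mu> * x) * max (norm (y' x + \<sigma> * y x)) (norm (y' x + (- \<sigma>) * y x)))"
  define N0 where "N0 = norm (y' 0) + norm \<sigma> * norm (y 0)"
  have absq: "(\<lambda>t. \<bar>q t\<bar>) absolutely_integrable_on {0..c}"
    using absolutely_integrable_norm[OF q] by (simp add: o_def)
  have yc: "continuous_on {0..c} y" "continuous_on {0..c} y'"
    using ode_sol_continuous[OF y] by auto
  have Nc: "continuous_on {0..c} N"
    unfolding N_def by (intro continuous_intros yc)
  \<comment> \<open>\<open>y\<close> is recovered from the difference of the two factors, which is
    \<open>2 * \<sigma> * y\<close>.\<close>
  have yN: "exp (- \<mu> * t) * norm (y t) \<le> N t / norm \<sigma>" for t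
  proof -
    define m where "m = max (norm (y' t + \<sigma> * y t)) (norm (y' t + (- \<sigma>) * y t))"
    have "2 * norm \<sigma> * norm (y t) = norm ((y' t + \<sigma> * y t) - (y' t + (- \<sigma>) * y t))"
      by (simp add: norm_mult)
    also have "\<dots> \<le> norm (y' t + \<sigma> * y t) + norm (y' t + (- \<sigma>) * y t)"
      by (rule norm_triangle_ineq4)
    also have "\<dots> \<le> 2 * m"
      unfolding m_def by simp
    finally have "norm (y t) * norm \<sigma> \<le> m"
      by (simp add: ac_simps)
    moreover have "0 < norm \<sigma>" using \<sigma>(2) by linarith
    ultimately have "norm (y t) \<le> m / norm \<sigma>"
      by (simp only: pos_le_divide_eq)
    then show ?thesis
      unfolding N_def m_def[symmetric] times_divide_eq_right[symmetric] by (intro mult_left_mono) auto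
  qed
  have Nnn: "0 \<le> N t" for t by (simp add: N_def le_max_iff_disj)
  have "N x \<le> N0 * exp (integral {0..x} (\<lambda>t. \<bar>q t\<bar>))"
  proof (rule gronwall_L1[OF Nc absq])
    fix x assume x: "x \<in> {0..c}"
    have gN: "(\<lambda>t. \<bar>q t\<bar> * N t) integrable_on {0..x}"
      using absolutely_integrable_bilinear_continuous(2)[OF bounded_bilinear_mult Nc absq] x
      by (auto simp: mult.commute intro: integrable_on_subinterval)
    have main: "exp (- \<mu> * x) * norm (y' x + \<tau> * y x) \<le> N0 + integral {0..x} (\<lambda>t. \<bar>q t\<bar> * N t)"
      if \<tau>: "\<tau> = \<sigma> \<or> \<tau> = - \<sigma>" for \<tau>
    proof -
      have re: "\<bar>Re \<tau>\<bar> = \<mu>" "\<tau>\<^sup>2 = - z" "norm \<tau> = norm \<sigma>" using \<tau> \<sigma> by (auto simp: \<mu>_def)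
      \<comment> \<open>Multiplying by \<open>?E \<le> 1\<close> turns the weight
        \<open>exp (- Re \<tau> * x)\<close> into \<open>exp (- \<mu> * x)\<close>; its reciprocal
        bounds the change of weight under the integral because \<open>t \<le> x\<close>.\<close>
      let ?E = "exp ((Re \<tau> - \<mu>) * x)"
      have E: "?E \<le> 1" using re x by (auto simp: mult_le_0_iff)
      have E1: "?E * exp ((\<mu> - Re \<tau>) * x) = 1" and E2: "?E * exp (- Re \<tau> * x) = exp (- \<mu> * x)"
        by (simp_all add: algebra_simps flip: exp_add)
      have "exp (- Re \<tau> * x) * norm (y' x + \<tau> * y x) \<le> norm (y' 0 + \<tau> * y 0) +
          integral {0..x} (\<lambda>t. exp ((\<mu> - Re \<tau>) * x) * (\<bar>q t\<bar> * N t))"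
      proof (rule ode_sol_first_order_bound[OF y re(2) x])
        show "(\<lambda>t. exp ((\<mu> - Re \<tau>) * x) * (\<bar>q t\<bar> * N t)) integrable_on {0..x}"
          using gN by (rule integrable_on_mult_right)
        fix t assume t: "t \<in> {0..x}"
        have "(\<mu> - Re \<tau>) * t \<le> (\<mu> - Re \<tau>) * x"
          using t re by (intro mult_left_mono) auto
        then have "exp (- Re \<tau> * t) \<le> exp ((\<mu> - Re \<tau>) * x) * exp (- \<mu> * t)"
          by (simp add: algebra_simps flip: exp_add)
        then have "exp (- Re \<tau> * t) * (\<bar>q t\<bar> * norm (y t)) \<le> exp ((\<mu> - Re \<tau>) * x) * exp (- \<mu> * t) * (\<bar>q t\<bar> * norm (y t))"
          by (intro mult_right_mono) auto
        also have "\<dots> = exp ((\<mu> - Re \<tau>) * x) * (\<bar>q t\<bar> * (exp (- \<mu> * t) * norm (y t)))"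
          by simp
        also have "\<dots> \<le> exp ((\<mu> - Re \<tau>) * x) * (\<bar>q t\<bar> * N t)"
        proof (intro mult_left_mono)
          have "N t / norm \<sigma> \<le> N t / 1"
            using \<sigma>(2) Nnn[of t] by (intro divide_left_mono) auto
          then show "exp (- \<mu> * t) * norm (y t) \<le> N t" using yN[of t] by simp
        qed auto
        finally show "exp (- Re \<tau> * t) * (\<bar>q t\<bar> * norm (y t)) \<le> exp ((\<mu> - Re \<tau>) * x) * (\<bar>q t\<bar> * N t)" .
      qed
      then have "?E * (exp (- Re \<tau> * x) * norm (y' x + \<tau> * y x)) \<le> ?E * (norm (y' 0 + \<tau> * y 0) +
          exp ((\<mu> - Re \<tau>) * x) * integral {0..x} (\<lambda>t. \<bar>q t\<bar> * N t))"
        by (intro mult_left_mono) auto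
      also have "\<dots> = ?E * norm (y' 0 + \<tau> * y 0) + integral {0..x} (\<lambda>t. \<bar>q t\<bar> * N t)"
        unfolding distrib_left mult.assoc[symmetric] E1 by simp
      also have "\<dots> \<le> 1 * norm (y' 0 + \<tau> * y 0) + integral {0..x} (\<lambda>t. \<bar>q t\<bar> * N t)"
        using E by (intro add_right_mono mult_right_mono) auto
      also have "norm (y' 0 + \<tau> * y 0) \<le> N0"
        using norm_triangle_ineq[of "y' 0" "\<tau> * y 0"] re by (simp add: N0_def norm_mult)
      also have "?E * (exp (- Re \<tau> * x) * norm (y' x + \<tau> * y x)) = exp (- \<mu> * x) * norm (y' x + \<tau> * y x)"
        unfolding mult.assoc[symmetric] E2 ..
      finally show ?thesis by simp
    qed
    then show "N x \<le> N0 + integral {0..x} (\<lambda>t. \<bar>q t\<bar> * N t)"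
      using main[of \<sigma>] main[of "- \<sigma>"] unfolding N_def by (simp add: max_def)
  qed (use x in \<open>auto simp: N0_def\<close>)
  also have "\<dots> \<le> N0 * exp (integral {0..c} (\<lambda>t. \<bar>q t\<bar>))"
    using absq x by (intro mult_left_mono, simp, intro integral_subset_le)
      (auto simp: absolutely_integrable_on_def N0_def intro: integrable_on_subinterval)
  finally have "exp (- \<mu> * x) * norm (y x) \<le> N0 * exp (integral {0..c} (\<lambda>t. \<bar>q t\<bar>)) / norm \<sigma>"
    using yN[of x] by (meson divide_right_mono norm_ge_zero order_trans)
  then have "exp (\<mu> * x) * (exp (- \<mu> * x) * norm (y x)) \<le> exp (\<mu> * x) * (N0 * exp (integral {0..c} (\<lambda>t. \<bar>q t\<bar>)) / norm \<sigma>)"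
    by (intro mult_left_mono) auto
  also have "exp (\<mu> * x) * (exp (- \<mu> * x) * norm (y x)) = norm (y x)"
    by (simp flip: exp_add mult.assoc)
  also have "exp (\<mu> * x) * (N0 * exp (integral {0..c} (\<lambda>t. \<bar>q t\<bar>)) / norm \<sigma>)
    = (norm (y' 0) / norm \<sigma> + norm (y 0)) * exp (integral {0..c} (\<lambda>t. \<bar>q t\<bar>)) * exp (\<mu> * x)"
  proof -
    have "\<sigma> \<noteq> 0" using \<sigma>(2) by auto
    then have "norm (y' 0) / norm \<sigma> + norm (y 0) = N0 / norm \<sigma>"
      by (simp add: N0_def add_divide_distrib)
    then show ?thesis by (simp add: ac_simps)
  qed
  finally show ?thesis by (simp add: \<mu>_def)
qed

text \<open>
  The bound on \<open>y' \<bullet> y\<close> says that \<open>r = y' - \<kappa> y\<close> dominates \<open>y' + \<kappa> y\<close>, and hence \<open>\<kappa> y\<close>; up to the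
  perturbation \<open>q y\<close>, \<open>r\<close> satisfies \<open>r' = -\<kappa> r\<close>.
\<close>

lemma ode_sol_decay:
  assumes y: "ode_sol q (- (of_real \<kappa>)\<^sup>2) c y y'" and q: "q absolutely_integrable_on {0..c}"
    and S: "\<And>x. x \<in> {0..c} \<Longrightarrow> y' x \<bullet> y x \<le> S * (norm (y x))\<^sup>2"
    and \<kappa>: "2 \<le> \<kappa>" "4 * S \<le> \<kappa>" and x: "x \<in> {0..c}"
  shows "norm (y x) \<le> 2 / \<kappa> * norm (y' 0 - of_real \<kappa> * y 0) * exp (integral {0..c} (\<lambda>t. \<bar>q t\<bar>)) * exp (- \<kappa> * x)"
proof -
  define r where "r = (\<lambda>x. y' x + (- of_real \<kappa>) * y x)"
  define N where "N = (\<lambda>x. exp (\<kappa> * x) * norm (r x))"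
  have absq: "(\<lambda>t. \<bar>q t\<bar>) absolutely_integrable_on {0..c}"
    using absolutely_integrable_norm[OF q] by (simp add: o_def)
  have yc: "continuous_on {0..c} y" "continuous_on {0..c} y'"
    using ode_sol_continuous[OF y] by auto
  have Nc: "continuous_on {0..c} N"
    unfolding N_def r_def by (intro continuous_intros yc)
  have y_le: "norm (y t) \<le> 2 / \<kappa> * norm (r t)" if t: "t \<in> {0..c}" for t
  proof -
    define p where "p = y' t + of_real \<kappa> * y t"
    define R where "R = r t"
    have pR: "p - R = of_real (2 * \<kappa>) * y t" by (simp add: p_def R_def r_def)
    have ny: "2 * \<kappa> * norm (y t) = norm (p - R)"
      using \<kappa> unfolding pR by (simp add: norm_mult)
    \<comment> \<open>The bounds on \<open>y' \<bullet> y\<close> and on \<open>4 * S\<close> keep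
      this difference below a quarter of \<open>(norm (p - R))\<^sup>2\<close>, which leaves
      \<open>(norm p)\<^sup>2 \<le> 3 * (norm R)\<^sup>2\<close>.\<close>
    have "(norm p)\<^sup>2 - (norm R)\<^sup>2 = 4 * \<kappa> * (y' t \<bullet> y t)"
      unfolding p_def R_def r_def dot_square_norm[symmetric] inner_complex_def
      by (simp add: algebra_simps)
    also have "\<dots> \<le> 4 * \<kappa> * (S * (norm (y t))\<^sup>2)"
      using S[OF t] \<kappa> by (intro mult_left_mono) auto
    also have "\<dots> = S * 4 * (\<kappa> * (norm (y t))\<^sup>2)" by simp
    also have "\<dots> \<le> \<kappa> * (\<kappa> * (norm (y t))\<^sup>2)"
      using \<kappa> by (intro mult_right_mono) auto
    also have "\<dots> = (norm (p - R))\<^sup>2 / 4"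
      unfolding ny[symmetric] by (simp add: power2_eq_square)
    also have "\<dots> \<le> (2 * (norm p)\<^sup>2 + 2 * (norm R)\<^sup>2) / 4"
    proof -
      have "(norm (p - R))\<^sup>2 \<le> (norm p + norm R)\<^sup>2"
        by (intro power_mono norm_triangle_ineq4) auto
      also have "\<dots> \<le> 2 * (norm p)\<^sup>2 + 2 * (norm R)\<^sup>2"
        using zero_le_power2[of "norm p - norm R"] unfolding power2_sum power2_diff by linarith
      finally show ?thesis by simp
    qed
    finally have "(norm p)\<^sup>2 \<le> 3 * (norm R)\<^sup>2" by (simp add: field_simps)
    also have "\<dots> \<le> (2 * norm R)\<^sup>2" by (simp add: power_mult_distrib)
    finally have "norm p \<le> 2 * norm R" by (rule power2_le_imp_le) simp
    then have "2 * \<kappa> * norm (y t) \<le> 3 * norm R"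
      unfolding ny using norm_triangle_ineq4[of p R] by linarith
    then have "\<kappa> * norm (y t) \<le> 2 * norm R"
      using norm_ge_zero[of R] by linarith
    then show ?thesis using \<kappa> by (simp add: R_def field_simps)
  qed
  have "N x \<le> norm (r 0) * exp (integral {0..x} (\<lambda>t. \<bar>q t\<bar>))"
  proof (rule gronwall_L1[OF Nc absq])
    fix x assume x: "x \<in> {0..c}"
    have gN: "(\<lambda>t. \<bar>q t\<bar> * N t) integrable_on {0..x}"
      using absolutely_integrable_bilinear_continuous(2)[OF bounded_bilinear_mult Nc absq] x
      by (auto simp: mult.commute intro: integrable_on_subinterval)
    have "exp (- Re (- of_real \<kappa>) * x) * norm (y' x + (- of_real \<kappa>) * y x)
        \<le> norm (y' 0 + (- of_real \<kappa>) * y 0) + integral {0..x} (\<lambda>t. \<bar>q t\<bar> * N t)"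
    proof (rule ode_sol_first_order_bound[OF y _ x gN])
      fix t assume t: "t \<in> {0..x}"
      \<comment> \<open>With \<open>2 \<le> \<kappa>\<close> the factor \<open>2 / \<kappa>\<close>
        is at most 1, so the Gronwall coefficient is \<open>\<bar>q t\<bar>\<close> itself.\<close>
      have "norm (y t) \<le> 2 / \<kappa> * norm (r t)" using t x by (intro y_le) auto
      also have "\<dots> \<le> 1 * norm (r t)" using \<kappa> by (intro mult_right_mono) auto
      finally have "exp (\<kappa> * t) * (\<bar>q t\<bar> * norm (y t)) \<le> exp (\<kappa> * t) * (\<bar>q t\<bar> * norm (r t))"
        by (intro mult_left_mono) auto
      then show "exp (- Re (- of_real \<kappa>) * t) * (\<bar>q t\<bar> * norm (y t)) \<le> \<bar>q t\<bar> * N t"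
        by (simp add: N_def ac_simps)
    qed simp
    then show "N x \<le> norm (r 0) + integral {0..x} (\<lambda>t. \<bar>q t\<bar> * N t)"
      by (simp add: N_def r_def)
  qed (use x in auto)
  also have "\<dots> \<le> norm (r 0) * exp (integral {0..c} (\<lambda>t. \<bar>q t\<bar>))"
    using absq x by (intro mult_left_mono, simp, intro integral_subset_le)
      (auto simp: absolutely_integrable_on_def intro: integrable_on_subinterval)
  finally have Nx: "N x \<le> norm (r 0) * exp (integral {0..c} (\<lambda>t. \<bar>q t\<bar>))" .
  have "norm (y x) \<le> 2 / \<kappa> * norm (r x)" using x by (rule y_le)
  also have "norm (r x) = N x * exp (- \<kappa> * x)"
    by (simp add: N_def ac_simps flip: exp_add)
  also have "2 / \<kappa> * (N x * exp (- \<kappa> * x)) \<le> 2 / \<kappa> * (norm (r 0) * exp (integral {0..c} (\<lambda>t. \<bar>q t\<bar>)) * exp (- \<kappa> * x))"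
    using Nx \<kappa> by (intro mult_left_mono mult_right_mono) auto
  finally show ?thesis by (simp add: r_def ac_simps)
qed

section \<open>Fundamental solutions and their dependence on the spectral parameter\<close>

locale fundamental_system =
  fixes q :: "real \<Rightarrow> real" and c :: real and \<theta> \<theta>' \<phi> \<phi>' :: "complex \<Rightarrow> real \<Rightarrow> complex"
  assumes c_pos: "0 < c" and q_integrable: "q absolutely_integrable_on {0..c}"
    and sol_\<theta>: "ode_sol q z c (\<theta> z) (\<theta>' z)" and sol_\<phi>: "ode_sol q z c (\<phi> z) (\<phi>' z)"
    and init_\<theta>: "\<theta> z 0 = 1" "\<theta>' z 0 = 0" and init_\<phi>: "\<phi> z 0 = 0" "\<phi>' z 0 = 1"

lemma fundamental_system_exists:
  assumes "0 < c" "q absolutely_integrable_on {0..c}"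
  shows "\<exists>\<theta> \<theta>' \<phi> \<phi>'. fundamental_system q c \<theta> \<theta>' \<phi> \<phi>'"
proof -
  obtain \<theta> \<theta>' where "\<And>z. \<theta> z 0 = 1 \<and> \<theta>' z 0 = 0 \<and> ode_sol q z c (\<theta> z) (\<theta>' z)"
    using ode_sol_exists[OF assms, of 1 0] by metis
  moreover obtain \<phi> \<phi>' where "\<And>z. \<phi> z 0 = 0 \<and> \<phi>' z 0 = 1 \<and> ode_sol q z c (\<phi> z) (\<phi>' z)"
    using ode_sol_exists[OF assms, of 0 1] by metis
  ultimately show ?thesis
    unfolding fundamental_system_def using assms by blast
qed

context fundamental_system
begin

lemma wronskian: "x \<in> {0..c} \<Longrightarrow> \<theta> z x * \<phi>' z x - \<theta>' z x * \<phi> z x = 1"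
  using wronskian_const[OF sol_\<theta> sol_\<phi>] by (simp add: init_\<theta> init_\<phi>)

text \<open>The Wronskians of \<open>y\<close> with the two solutions at \<open>w\<close> have
  derivatives with the factor \<open>w - z\<close>; the resulting relations are solved for
  \<open>y x\<close> because the Wronskian of the system is 1. Comparing two spectral parameters in
  this way prepares the differentiation in \<open>z\<close>.\<close>

lemma variation_of_constants:
  assumes y: "ode_sol q z c y y'" and x: "x \<in> {0..c}"
  shows "y x = y 0 * \<theta> w x + y' 0 * \<phi> w x
      + (w - z) * integral {0..x} (\<lambda>t. (\<phi> w x * \<theta> w t - \<theta> w x * \<phi> w t) * y t)"
proof -
  note A = is_primitive_wronskian[OF sol_\<theta> y, of w] and B = is_primitive_wronskian[OF sol_\<phi> y, of w]
  define I where "I = integral {0..x} (\<lambda>t. (w - z) * (\<theta> w t * y t))"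
  define J where "J = integral {0..x} (\<lambda>t. (w - z) * (\<phi> w t * y t))"
  have A': "\<theta> w x * y' x - \<theta>' w x * y x = y' 0 + I"
    using is_primitive_eq[OF A, of x] x by (simp add: init_\<theta> I_def)
  have B': "\<phi> w x * y' x - \<phi>' w x * y x = - y 0 + J"
    using is_primitive_eq[OF B, of x] x by (simp add: init_\<phi> J_def)
  have int: "(\<lambda>t. (w - z) * (\<theta> w t * y t)) integrable_on {0..x}"
    "(\<lambda>t. (w - z) * (\<phi> w t * y t)) integrable_on {0..x}"
    using is_primitive_subinterval(2)[OF A, of 0 x] is_primitive_subinterval(2)[OF B, of 0 x] x by auto
  have "y x = y x * (\<theta> w x * \<phi>' w x - \<theta>' w x * \<phi> w x)" using wronskian[OF x] by simp
  also have "\<dots> = \<phi> w x * (\<theta> w x * y' x - \<theta>' w x * y x) - \<theta> w x * (\<phi> w x * y' x - \<phi>' w x * y x)"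
    by (simp add: algebra_simps)
  also have "\<dots> = y 0 * \<theta> w x + y' 0 * \<phi> w x + (\<phi> w x * I - \<theta> w x * J)"
    unfolding A' B' by (simp add: algebra_simps)
  also have "\<phi> w x * I - \<theta> w x * J = integral {0..x} (\<lambda>t. \<phi> w x * ((w - z) * (\<theta> w t * y t)) - \<theta> w x * ((w - z) * (\<phi> w t * y t)))"
    using int unfolding I_def J_def
    by (subst Henstock_Kurzweil_Integration.integral_diff) (auto intro: integrable_on_mult_right)
  also have "\<dots> = integral {0..x} (\<lambda>t. (w - z) * ((\<phi> w x * \<theta> w t - \<theta> w x * \<phi> w t) * y t))"
    by (simp add: algebra_simps)
  finally show ?thesis by simp
qed

lemma ode_sol_expansion:
  assumes "ode_sol q z c y y'" "x \<in> {0..c}"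
  shows "y x = y 0 * \<theta> z x + y' 0 * \<phi> z x"
  using variation_of_constants[OF assms, of z] by simp

text \<open>Variation of constants writes \<open>Y z x - Y w x\<close> as \<open>w - z\<close> times
  an integral of \<open>Y z\<close> against a kernel that depends only on \<open>w\<close>. Used
  twice, it first gives continuity in \<open>z\<close>, uniformly on the interval, and then the
  limit of the difference quotient.\<close>

lemma ode_sol_holomorphic:
  fixes Y Y' :: "complex \<Rightarrow> real \<Rightarrow> complex"
  assumes Y: "\<And>z. ode_sol q z c (Y z) (Y' z)" "\<And>z. Y z 0 = \<alpha>" "\<And>z. Y' z 0 = \<beta>"
    and x: "x \<in> {0..c}"
  shows "(\<lambda>z. Y z x) holomorphic_on UNIV"
proof -
  have "\<exists>D. ((\<lambda>z. Y z x) has_field_derivative D) (at w)" for w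
  proof -
    define k where "k = (\<lambda>s t. \<phi> w s * \<theta> w t - \<theta> w s * \<phi> w t)"
    have cont: "continuous_on {0..c} (\<theta> w)" "continuous_on {0..c} (\<phi> w)" "continuous_on {0..c} (Y z)" for z
      using ode_sol_continuous sol_\<theta> sol_\<phi> Y by blast+
    have kY: "(\<lambda>t. k s t * Y z t) integrable_on {0..s}" if "s \<in> {0..c}" for s z
      unfolding k_def using that
      by (intro integrable_continuous_real continuous_intros) (auto intro: continuous_on_subset[OF cont(1)] continuous_on_subset[OF cont(2)] continuous_on_subset[OF cont(3)])
    obtain K1 where K1: "\<And>z t. z \<in> ball w 1 \<Longrightarrow> t \<in> {0..c} \<Longrightarrow> norm (Y z t) \<le> K1"
    proof
      fix z t assume zt: "z \<in> ball w 1" "t \<in> {0..c}"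
      have "norm z \<le> norm w + 1"
        using zt norm_triangle_ineq4[of w "w - z"] by (simp add: dist_norm)
      from ode_sol_bound[OF Y(1) q_integrable this zt(2)]
      show "norm (Y z t) \<le> (norm \<alpha> + norm \<beta>) * exp (integral {0..c} (\<lambda>t. 1 + (norm w + 1) + \<bar>q t\<bar>))"
        by (simp add: Y)
    qed
    have "bounded (\<theta> w ` {0..c})" "bounded (\<phi> w ` {0..c})"
      using cont compact_continuous_image compact_imp_bounded by blast+
    then obtain a b where a: "\<And>t. t \<in> {0..c} \<Longrightarrow> norm (\<theta> w t) \<le> a" and b: "\<And>t. t \<in> {0..c} \<Longrightarrow> norm (\<phi> w t) \<le> b"
      unfolding bounded_iff by (meson imageI)
    have K2: "norm (k s t) \<le> 2 * (a * b)" if "s \<in> {0..c}" "t \<in> {0..c}" for s t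
    proof -
      have "norm (k s t) \<le> norm (\<phi> w s) * norm (\<theta> w t) + norm (\<theta> w s) * norm (\<phi> w t)"
        unfolding k_def norm_mult[symmetric] by (rule norm_triangle_ineq4)
      also have "\<dots> \<le> b * a + a * b"
        using a[OF that(1)] a[OF that(2)] b[OF that(1)] b[OF that(2)]
        by (intro add_mono mult_mono) (auto intro: order_trans[OF norm_ge_zero])
      finally show ?thesis by simp
    qed
    define K where "K = 2 * (a * b) * c"
    have zero: "0 \<in> {0..c}" using c_pos by simp
    have "a \<ge> 0" "b \<ge> 0" using a[OF zero] b[OF zero] by (auto intro: order_trans[OF norm_ge_zero])
    then have "K \<ge> 0" using c_pos by (simp add: K_def)
    have int_bound: "norm (integral {0..s} (\<lambda>t. k s t * u t)) \<le> K * B"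
      if s: "s \<in> {0..c}" and u: "continuous_on {0..c} u" and B: "\<And>t. t \<in> {0..c} \<Longrightarrow> norm (u t) \<le> B" for s u B
    proof -
      have "B \<ge> 0" using B[OF zero] by (auto intro: order_trans[OF norm_ge_zero])
      have "norm (integral {0..s} (\<lambda>t. k s t * u t)) \<le> 2 * (a * b) * B * (s - 0)"
      proof (rule integral_bound)
        show "continuous_on {0..s} (\<lambda>t. k s t * u t)"
          unfolding k_def using s
          by (intro continuous_intros) (auto intro: continuous_on_subset[OF cont(1)] continuous_on_subset[OF cont(2)] continuous_on_subset[OF u])
        show "norm (k s t * u t) \<le> 2 * (a * b) * B" if "t \<in> {0..s}" for t
          unfolding norm_mult using that s K2 B \<open>a \<ge> 0\<close> \<open>b \<ge> 0\<close> by (intro mult_mono) auto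
      qed (use s in auto)
      also have "\<dots> \<le> 2 * (a * b) * B * c"
        using s \<open>B \<ge> 0\<close> \<open>a \<ge> 0\<close> \<open>b \<ge> 0\<close> by (intro mult_left_mono) auto
      finally show ?thesis by (simp add: K_def ac_simps)
    qed
    have diff: "Y z s - Y w s = (w - z) * integral {0..s} (\<lambda>t. k s t * Y z t)" if "s \<in> {0..c}" for z s
      using variation_of_constants[OF Y(1) that, of z w] ode_sol_expansion[OF Y(1) that, of w]
      by (simp add: Y k_def)
    have Ydiff: "norm (Y z t - Y w t) \<le> norm (w - z) * (K * K1)" if "z \<in> ball w 1" "t \<in> {0..c}" for z t
      unfolding diff[OF that(2)] norm_mult using that K1 cont
      by (intro mult_left_mono int_bound) auto
    \<comment> \<open>The expected derivative: \<open>Y z\<close> under the integral is replaced by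
      \<open>Y w\<close>, and the sign comes from \<open>w - z\<close> against
      \<open>z - w\<close>.\<close>
    define D where "D = - integral {0..x} (\<lambda>t. k x t * Y w t)"
    have quot: "norm ((Y z x - Y w x) / (z - w) - D) \<le> norm (w - z) * (K * (K * K1))"
      if z: "z \<in> ball w 1" "z \<noteq> w" for z
    proof -
      have "(Y z x - Y w x) / (z - w) - D = - (integral {0..x} (\<lambda>t. k x t * Y z t) - integral {0..x} (\<lambda>t. k x t * Y w t))"
        using z unfolding diff[OF x] D_def by (simp add: divide_simps) (simp add: algebra_simps)
      also have "integral {0..x} (\<lambda>t. k x t * Y z t) - integral {0..x} (\<lambda>t. k x t * Y w t)
          = integral {0..x} (\<lambda>t. k x t * (Y z t - Y w t))"
        using kY[OF x] by (simp add: right_diff_distrib Henstock_Kurzweil_Integration.integral_diff)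
      also have "norm (- \<dots>) \<le> K * (norm (w - z) * (K * K1))"
        unfolding norm_minus_cancel using z Ydiff cont x by (intro int_bound continuous_on_diff) auto
      finally show ?thesis by (simp add: ac_simps)
    qed
    have "((\<lambda>z. (Y z x - Y w x) / (z - w) - D) \<longlongrightarrow> 0) (at w)"
    proof (rule Lim_null_comparison)
      have "eventually (\<lambda>z. z \<in> ball w 1 \<and> z \<noteq> w) (at w)"
        by (auto simp: eventually_at dist_commute intro!: exI[of _ 1])
      then show "eventually (\<lambda>z. norm ((Y z x - Y w x) / (z - w) - D) \<le> norm (w - z) * (K * (K * K1))) (at w)"
        by eventually_elim (use quot in auto)
      have "((\<lambda>z. norm (w - z) * (K * (K * K1))) \<longlongrightarrow> norm (w - w) * (K * (K * K1))) (at w)"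
        by (intro tendsto_intros)
      then show "((\<lambda>z. norm (w - z) * (K * (K * K1))) \<longlongrightarrow> 0) (at w)" by simp
    qed
    then have "((\<lambda>z. Y z x) has_field_derivative D) (at w)"
      unfolding has_field_derivative_iff using Lim_null by blast
    then show ?thesis ..
  qed
  then show ?thesis
    by (auto simp: holomorphic_on_def field_differentiable_def)
qed

text \<open>Here \<open>\<sigma>\<close> is \<open>\<i> * k\<close>, so the growth is governed by
  \<open>\<bar>Im k\<bar>\<close> alone: both solutions stay bounded for real \<open>k\<close> with
  \<open>1 \<le> norm k\<close>.\<close>

lemma exponential_bounds:
  assumes k: "1 \<le> norm k" and x: "x \<in> {0..c}"
  shows "norm (\<theta> (k\<^sup>2) x) \<le> exp (integral {0..c} (\<lambda>t. \<bar>q t\<bar>)) * exp (\<bar>Im k\<bar> * x)"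
    "norm (\<phi> (k\<^sup>2) x) \<le> exp (integral {0..c} (\<lambda>t. \<bar>q t\<bar>)) * exp (\<bar>Im k\<bar> * x) / norm k"
proof -
  have \<sigma>: "(\<i> * k)\<^sup>2 = - (k\<^sup>2)" "1 \<le> norm (\<i> * k)"
    using k by (auto simp: power_mult_distrib norm_mult)
  show "norm (\<theta> (k\<^sup>2) x) \<le> exp (integral {0..c} (\<lambda>t. \<bar>q t\<bar>)) * exp (\<bar>Im k\<bar> * x)"
    using ode_sol_exponential_bound[OF sol_\<theta> q_integrable \<sigma> x] by (simp add: init_\<theta>)
  show "norm (\<phi> (k\<^sup>2) x) \<le> exp (integral {0..c} (\<lambda>t. \<bar>q t\<bar>)) * exp (\<bar>Im k\<bar> * x) / norm k"
    using ode_sol_exponential_bound[OF sol_\<phi> q_integrable \<sigma> x] by (simp add: init_\<phi> norm_mult)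
qed

end

subsection \<open>A Phragmen-Lindelof principle\<close>

text \<open>If the argument of \<open>v\<close> is at most pi/4 in modulus, that of
  \<open>csqrt v\<close> is at most pi/8 and that of its cube at most 3 pi/8, so the real part of
  the cube stays comparable with its modulus. The constants come from
  \<open>2 * \<bar>b\<bar> \<le> a\<close>.\<close>

lemma Re_csqrt_cube_ge:
  assumes "\<bar>Im v\<bar> \<le> Re v"
  shows "(Re (csqrt v)) ^ 3 / 4 \<le> Re (csqrt v ^ 3)" "norm v \<le> 5 / 4 * (Re (csqrt v))\<^sup>2"
proof -
  define a b where "a = Re (csqrt v)" and "b = Im (csqrt v)"
  have "a \<ge> 0" unfolding a_def using Re_csqrt .
  have cs: "csqrt v = Complex a b" by (simp only: a_def b_def complex.collapse)
  have v: "v = (Complex a b)\<^sup>2" unfolding cs[symmetric] by (rule power2_csqrt[symmetric])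
  have R: "Re v = a\<^sup>2 - b\<^sup>2" and I: "Im v = 2 * a * b"
    unfolding v by (simp_all add: power2_eq_square)
  have b: "4 * b\<^sup>2 \<le> a\<^sup>2"
  proof (cases "a = 0")
    case True
    then show ?thesis using assms R I by (simp add: power2_eq_square)
  next
    case False
    have "2 * a * \<bar>b\<bar> \<le> a\<^sup>2 - b\<^sup>2"
      using assms R I \<open>a \<ge> 0\<close> by (simp add: abs_mult)
    also have "\<dots> \<le> a\<^sup>2" by simp
    finally have "2 * a * \<bar>b\<bar> \<le> a\<^sup>2" .
then have "2 * \<bar>b\<bar> \<le> a" using False \<open>a \<ge> 0\<close> by (simp add: power2_eq_square)
    then have "(2 * \<bar>b\<bar>)\<^sup>2 \<le> a\<^sup>2" by (intro power_mono) auto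
    then show ?thesis by (simp add: power_mult_distrib)
  qed
  have "Re (csqrt v ^ 3) = a * (a\<^sup>2 - 3 * b\<^sup>2)"
    unfolding cs by (simp add: power3_eq_cube power2_eq_square algebra_simps)
  also have "\<dots> \<ge> a * (a\<^sup>2 / 4)"
    using b \<open>a \<ge> 0\<close> by (intro mult_left_mono) auto
  finally show "(Re (csqrt v)) ^ 3 / 4 \<le> Re (csqrt v ^ 3)"
    by (simp add: cs power3_eq_cube power2_eq_square)
  have "norm v = (norm (csqrt v))\<^sup>2" by (simp only: norm_power[symmetric] power2_csqrt)
  also have "\<dots> = a\<^sup>2 + b\<^sup>2" by (simp add: cs cmod_power2)
  finally show "norm v \<le> 5 / 4 * (Re (csqrt v))\<^sup>2" using b by (simp add: cs)
qed

text \<open>The sector has opening pi/2, for which order 2 is critical, while the growth is of order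
  1. A damping factor of the intermediate order 3/2 makes the maximum principle effective on a
  truncated sector; then \<open>\<epsilon>\<close> tends to 0.\<close>

lemma phragmen_lindelof_sector:
  assumes hol: "f holomorphic_on UNIV"
    and growth: "\<And>w. norm (f w) \<le> C * exp (B * norm w)" and "B \<ge> 0"
    and bdry: "\<And>w. \<bar>Im w\<bar> = Re w \<Longrightarrow> norm (f w) \<le> M" and "M > 0"
    and w0: "\<bar>Im w0\<bar> \<le> Re w0"
  shows "norm (f w0) \<le> M"
proof -
  have "C \<ge> 0"
    using order_trans[OF norm_ge_zero growth[of 0]] by simp
  \<comment> \<open>the real part of \<open>(w + 1)\<^bsup>3/2\<^esup>\<close> grows like \<open>|w|\<^bsup>3/2\<^esup>\<close> in the sector; the shift avoids the branch point\<close>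
  define s where "s = (\<lambda>w. csqrt (w + 1))"
  have bound: "norm (f w0) \<le> M * exp (\<epsilon> * Re (s w0 ^ 3))" if "\<epsilon> > 0" for \<epsilon>
  proof -
    define h where "h = (\<lambda>w. f w * exp (- of_real \<epsilon> * s w ^ 3))"
    \<comment> \<open>The threshold \<open>C / M\<close> is chosen because
      \<open>C * exp (- (C / M)) \<le> M\<close>, which bounds the damped function on the
      arc.\<close>
    have "filterlim (\<lambda>a. \<epsilon> * a ^ 3 / 4 - B * (5 / 4 * a\<^sup>2 + 1)) at_top at_top"
      using \<open>\<epsilon> > 0\<close> \<open>B \<ge> 0\<close>
      by real_asymp
    then have "eventually (\<lambda>a. \<epsilon> * a ^ 3 / 4 - B * (5 / 4 * a\<^sup>2 + 1) \<ge> C / M) at_top"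
      by (simp add: filterlim_at_top)
    then obtain A where A: "\<And>a. a \<ge> A \<Longrightarrow> C / M \<le> \<epsilon> * a ^ 3 / 4 - B * (5 / 4 * a\<^sup>2 + 1)"
      by (auto simp: eventually_at_top_linorder)
    \<comment> \<open>\<open>R\<close> makes the truncated sector contain \<open>w0\<close> and
      forces \<open>A \<le> Re (s w)\<close> on the arc.\<close>
    define R where "R = max (norm w0) (5 / 4 * A\<^sup>2)"
    define S where "S = {w. \<bar>Im w\<bar> \<le> Re w \<and> norm w \<le> R}"
    have norm_h: "norm (h w) = norm (f w) * exp (- \<epsilon> * Re (s w ^ 3))" for w
      by (simp add: h_def norm_mult)
    have sector: "\<bar>Im (w + 1)\<bar> \<le> Re (w + 1)" if "\<bar>Im w\<bar> \<le> Re w" for w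
      using that by simp
    have hol_h: "h holomorphic_on {w. Re w > - 1}"
      unfolding h_def s_def
      by (intro holomorphic_intros holomorphic_on_subset[OF hol])
        (auto simp: complex_nonpos_Reals_iff)
    have sub: "S \<subseteq> {w. Re w > - 1}" by (auto simp: S_def)
    have "closed S"
      unfolding S_def by (intro closed_Collect_conj closed_Collect_le continuous_intros)
    have "norm (h w0) \<le> M"
    proof (rule maximum_modulus_frontier[where f = h and S = S])
      show "h holomorphic_on interior S"
        using hol_h sub interior_subset holomorphic_on_subset by blast
      show "continuous_on (closure S) h"
        using hol_h sub \<open>closed S\<close> holomorphic_on_imp_continuous_on continuous_on_subset
        by (metis closure_closed)
      show "bounded S" unfolding bounded_iff S_def by blast
      show "w0 \<in> S" using w0 by (simp add: S_def R_def)
      fix w assume "w \<in> frontier S"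
      then have wS: "w \<in> S" and nint: "w \<notin> interior S"
        using \<open>closed S\<close> by (auto simp: frontier_def closure_closed)
      then have w: "\<bar>Im w\<bar> \<le> Re w" "norm w \<le> R" by (auto simp: S_def)
      have cs: "Re (s w) ^ 3 / 4 \<le> Re (s w ^ 3)" "norm (w + 1) \<le> 5 / 4 * (Re (s w))\<^sup>2"
        unfolding s_def by (rule Re_csqrt_cube_ge[OF sector[OF w(1)]])+
      have "\<bar>Im w\<bar> = Re w \<or> norm w = R"
      proof (rule ccontr)
        assume "\<not> ?thesis"
        then have "w \<in> {w. \<bar>Im w\<bar> < Re w \<and> norm w < R}" using w by auto
        moreover have "open {w. \<bar>Im w\<bar> < Re w \<and> norm w < R}"
          by (intro open_Collect_conj open_Collect_less continuous_intros)
        moreover have "{w. \<bar>Im w\<bar> < Re w \<and> norm w < R} \<subseteq> S" by (auto simp: S_def)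
        ultimately show False using nint by (meson interiorI)
      qed
      then show "norm (h w) \<le> M"
      proof
        assume "\<bar>Im w\<bar> = Re w"
        then have "norm (f w) \<le> M" by (rule bdry)
        moreover have "exp (- \<epsilon> * Re (s w ^ 3)) \<le> 1"
        proof -
          have "0 \<le> Re (s w)" unfolding s_def by (rule Re_csqrt)
          then have "0 \<le> (Re (s w)) ^ 3 / 4" by simp
          then have "0 \<le> Re (s w ^ 3)" using cs(1) by linarith
          then show ?thesis using \<open>\<epsilon> > 0\<close> by simp
        qed
        ultimately have "norm (f w) * exp (- \<epsilon> * Re (s w ^ 3)) \<le> M * 1"
          using \<open>M > 0\<close> by (intro mult_mono) auto
        then show ?thesis by (simp add: norm_h)
      next
        assume R: "norm w = R"
        define a where "a = Re (s w)"
        have "a \<ge> 0" unfolding a_def s_def using Re_csqrt .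
        have w1: "norm w \<le> norm (w + 1)"
        proof -
          have "(norm w)\<^sup>2 \<le> (norm (w + 1))\<^sup>2"
            unfolding cmod_power2 using w(1) by (simp add: power2_eq_square algebra_simps)
          then show ?thesis by (rule power2_le_imp_le) simp
        qed
        then have Ra: "R \<le> 5 / 4 * a\<^sup>2" using cs(2) R by (simp add: a_def)
        then have "A\<^sup>2 \<le> a\<^sup>2" by (simp add: R_def)
        then have "A \<le> a" using \<open>a \<ge> 0\<close> by (rule power2_le_imp_le)
        then have *: "C / M \<le> \<epsilon> * a ^ 3 / 4 - B * (5 / 4 * a\<^sup>2 + 1)" by (rule A)
        have "norm (h w) \<le> C * exp (B * norm w) * exp (- \<epsilon> * Re (s w ^ 3))"
          unfolding norm_h using growth by (intro mult_right_mono) auto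
        also have "\<dots> = C * exp (B * norm w - \<epsilon> * Re (s w ^ 3))"
          by (simp add: exp_diff exp_minus field_simps)
        also have "\<dots> \<le> C * exp (- (C / M))"
        proof -
          have "B * norm w \<le> B * (5 / 4 * a\<^sup>2 + 1)"
            using \<open>B \<ge> 0\<close> R Ra by (intro mult_left_mono) auto
          moreover have "\<epsilon> * (a ^ 3 / 4) \<le> \<epsilon> * Re (s w ^ 3)"
            using \<open>\<epsilon> > 0\<close> cs(1) unfolding a_def by (intro mult_left_mono) auto
          ultimately have "B * norm w - \<epsilon> * Re (s w ^ 3) \<le> - (C / M)" using * by simp
          then show ?thesis using \<open>C \<ge> 0\<close> by (intro mult_left_mono) auto
        qed
        also have "\<dots> \<le> M"
        proof -
          have "C / M \<le> exp (C / M)" using exp_ge_add_one_self[of "C / M"] by linarith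
          then show ?thesis using \<open>M > 0\<close> by (simp add: exp_minus field_simps)
        qed
        finally show ?thesis .
      qed
    qed
    then have "norm (f w0) * exp (- \<epsilon> * Re (s w0 ^ 3)) * exp (\<epsilon> * Re (s w0 ^ 3)) \<le> M * exp (\<epsilon> * Re (s w0 ^ 3))"
      unfolding norm_h by (intro mult_right_mono) auto
    then show ?thesis by (simp add: mult.assoc flip: exp_add)
  qed
  \<comment> \<open>The point \<open>w0\<close> is fixed while the bound holds for all positive
    \<open>\<epsilon>\<close>, so the damping can be removed.\<close>
  have "((\<lambda>\<epsilon>. M * exp (\<epsilon> * Re (s w0 ^ 3))) \<longlongrightarrow> M * exp (0 * Re (s w0 ^ 3))) (at_right 0)"
    by (intro tendsto_intros)
  then show ?thesis
    using bound by (intro tendsto_lowerbound[of "\<lambda>\<epsilon>. M * exp (\<epsilon> * Re (s w0 ^ 3))" M "at_right 0"])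
      (auto simp: eventually_at_right_less intro: eventually_mono[OF eventually_at_right_less[of 0]])
qed

text \<open>Multiplication by \<open>1 + \<i>\<close> carries the sector
  \<open>\<bar>Im v\<bar> \<le> Re v\<close> onto the first quadrant; its modulus only enlarges the
  exponential type.\<close>

lemma phragmen_lindelof_quadrant:
  assumes hol: "g holomorphic_on UNIV"
    and growth: "\<And>w. norm (g w) \<le> C * exp (B * norm w)" and "B \<ge> 0"
    and bdry: "\<And>w. Re w = 0 \<or> Im w = 0 \<Longrightarrow> norm (g w) \<le> M" and "M > 0"
    and w: "0 \<le> Re w" "0 \<le> Im w"
  shows "norm (g w) \<le> M"
proof -
  define j where "j = Complex 1 1"
  define v where "v = Complex ((Re w + Im w) / 2) ((Im w - Re w) / 2)"
  have jv: "j * v = w" by (simp add: j_def v_def complex_eq_iff field_simps)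
  have nj: "norm j \<le> 2" using norm_triangle_ineq[of 1 \<i>] by (simp add: j_def complex_norm sqrt_le_D real_le_lsqrt)
  have "norm (g (j * v)) \<le> M"
  proof (rule phragmen_lindelof_sector[where f = "\<lambda>v. g (j * v)" and B = "B * 2"])
    show "(\<lambda>v. g (j * v)) holomorphic_on UNIV"
      using holomorphic_on_compose[of "\<lambda>v. j * v" UNIV g] hol
      by (auto simp: o_def intro: holomorphic_intros holomorphic_on_subset)
    show "norm (g (j * x)) \<le> C * exp (B * 2 * norm x)" for x
    proof -
      have "C \<ge> 0" using order_trans[OF norm_ge_zero growth[of 0]] by simp
      have "norm j * norm x \<le> 2 * norm x" using nj by (intro mult_right_mono) auto
      then have "B * norm (j * x) \<le> B * 2 * norm x"
        using mult_left_mono[OF _ \<open>B \<ge> 0\<close>] by (simp add: norm_mult mult.assoc)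
      then have "C * exp (B * norm (j * x)) \<le> C * exp (B * 2 * norm x)"
        using \<open>C \<ge> 0\<close> by (intro mult_left_mono) auto
      then show ?thesis using growth[of "j * x"] by linarith
    qed
    show "norm (g (j * x)) \<le> M" if "\<bar>Im x\<bar> = Re x" for x
      using that by (intro bdry) (auto simp: j_def abs_if split: if_splits)
    show "\<bar>Im v\<bar> \<le> Re v" using w by (auto simp: v_def)
  qed (use \<open>B \<ge> 0\<close> \<open>M > 0\<close> in auto)
  then show ?thesis by (simp add: jv)
qed

text \<open>The four quadrants are reduced to the first by multiplication with a power of
  \<open>\<i>\<close>; boundedness in all of them gives constancy by Liouville.\<close>

lemma entire_bounded_on_axes_constant:
  assumes hol: "g holomorphic_on UNIV"
    and growth: "\<And>w. norm (g w) \<le> C * exp (B * norm w)" and "B \<ge> 0"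
    and bdry: "\<And>w. Re w = 0 \<or> Im w = 0 \<Longrightarrow> norm (g w) \<le> M"
  shows "g constant_on UNIV"
proof -
  define M' where "M' = \<bar>M\<bar> + 1"
  have M': "M' > 0" and bdry': "\<And>w. Re w = 0 \<or> Im w = 0 \<Longrightarrow> norm (g w) \<le> M'"
    using bdry by (fastforce simp: M'_def)+
  have "norm (g w) \<le> M'" for w
  proof -
    obtain j where j: "j \<in> {1, \<i>, - 1, - \<i>}" "0 \<le> Re (cnj j * w)" "0 \<le> Im (cnj j * w)"
    proof -
      consider "0 \<le> Re w \<and> 0 \<le> Im w" | "Re w \<le> 0 \<and> 0 \<le> Im w" | "Re w \<le> 0 \<and> Im w \<le> 0" | "0 \<le> Re w \<and> Im w \<le> 0"
        by linarith
      then show ?thesis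
        by cases (use that[of 1] that[of \<i>] that[of "- 1"] that[of "- \<i>"] in auto)
    qed
    have jj: "j * cnj j = 1" "norm j = 1" using j(1) by auto
    have "norm (g (j * (cnj j * w))) \<le> M'"
    proof (rule phragmen_lindelof_quadrant[where g = "\<lambda>v. g (j * v)"])
      show "(\<lambda>v. g (j * v)) holomorphic_on UNIV"
        using holomorphic_on_compose[of "\<lambda>v. j * v" UNIV g] hol
        by (auto simp: o_def intro: holomorphic_intros holomorphic_on_subset)
      show "norm (g (j * x)) \<le> C * exp (B * norm x)" for x
        using growth[of "j * x"] jj by (simp add: norm_mult)
      show "norm (g (j * x)) \<le> M'" if "Re x = 0 \<or> Im x = 0" for x
        using that j(1) by (intro bdry') auto
    qed (use \<open>B \<ge> 0\<close> M' j in auto)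
    moreover have "j * (cnj j * w) = w" using jj by (simp flip: mult.assoc)
    ultimately show ?thesis by simp
  qed
  then show ?thesis
    using hol by (intro Liouville_theorem) (auto simp: bounded_iff)
qed

text \<open>For \<open>g k = F (k\<^sup>2)\<close>, the growth hypothesis bounds \<open>g\<close> on
  the real axis and the limit bounds it on the imaginary axis. Hence \<open>g\<close> is constant,
  the limit makes the constant 0, and every \<open>z\<close> is a square.\<close>

lemma entire_exponential_type_zero:
  assumes hol: "F holomorphic_on UNIV" and "B \<ge> 0"
    and growth: "\<And>k. 1 \<le> norm k \<Longrightarrow> norm (F (k\<^sup>2)) \<le> K * exp (B * \<bar>Im k\<bar>)"
    and lim: "((\<lambda>\<kappa>. F (- (of_real \<kappa>)\<^sup>2)) \<longlongrightarrow> 0) at_top"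
  shows "F z = 0"
proof -
  define g where "g = (\<lambda>k. F (k\<^sup>2))"
  have g: "g holomorphic_on UNIV"
    using holomorphic_on_compose[OF holomorphic_on_power[OF holomorphic_on_ident]
        holomorphic_on_subset[OF hol subset_UNIV], of 2 UNIV]
    by (simp add: o_def g_def)
  have Fc: "continuous_on A F" for A
    using hol holomorphic_on_imp_continuous_on continuous_on_subset by blast
  \<comment> \<open>The growth hypothesis says nothing for \<open>norm k < 1\<close>; compactness
    covers the unit disc.\<close>
  have "bounded (g ` cball 0 1)"
    using continuous_on_subset[OF holomorphic_on_imp_continuous_on[OF g]]
    by (intro compact_imp_bounded compact_continuous_image) auto
  then obtain K1 where K1: "\<And>k. norm k \<le> 1 \<Longrightarrow> norm (g k) \<le> K1"
    unfolding bounded_iff by (metis imageI mem_cball_0)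
  define K2 where "K2 = max K K1"
  have "K2 \<ge> 0" using K1[of 0] order_trans[OF norm_ge_zero K1[of 0]] by (simp add: K2_def)
  have gK: "norm (g k) \<le> K2 * exp (B * \<bar>Im k\<bar>)" for k
  proof (cases "1 \<le> norm k")
    case True
    then have "norm (g k) \<le> K * exp (B * \<bar>Im k\<bar>)" unfolding g_def by (rule growth)
    also have "\<dots> \<le> K2 * exp (B * \<bar>Im k\<bar>)" by (intro mult_right_mono) (auto simp: K2_def)
    finally show ?thesis .
  next
    case False
    then have "norm (g k) \<le> K2 * 1" using K1[of k] by (simp add: K2_def)
    also have "\<dots> \<le> K2 * exp (B * \<bar>Im k\<bar>)" using \<open>K2 \<ge> 0\<close> \<open>B \<ge> 0\<close> by (intro mult_left_mono) auto
    finally show ?thesis .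
  qed
  have "eventually (\<lambda>\<kappa>. norm (F (- (of_real \<kappa>)\<^sup>2)) < 1) at_top"
    using tendstoD[OF lim, of 1] by simp
  then obtain \<kappa>0 where \<kappa>0: "\<And>\<kappa>. \<kappa> \<ge> \<kappa>0 \<Longrightarrow> norm (F (- (of_real \<kappa>)\<^sup>2)) < 1"
    by (auto simp: eventually_at_top_linorder)
  \<comment> \<open>The limit controls only large \<open>\<kappa>\<close>; compactness covers the
    rest of the half axis.\<close>
  have "bounded ((\<lambda>\<kappa>. F (- (of_real \<kappa>)\<^sup>2)) ` {0..\<kappa>0})"
    by (intro compact_imp_bounded compact_continuous_image continuous_on_compose2[OF Fc[of UNIV]] continuous_intros) auto
  then obtain K3 where K3: "\<And>\<kappa>. \<kappa> \<in> {0..\<kappa>0} \<Longrightarrow> norm (F (- (of_real \<kappa>)\<^sup>2)) \<le> K3"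
    unfolding bounded_iff by (meson imageI)
  have imag: "norm (g k) \<le> max 1 K3" if "Re k = 0" for k
  proof -
    have "k\<^sup>2 = - (of_real \<bar>Im k\<bar>)\<^sup>2"
      using that by (simp add: complex_eq_iff power2_eq_square)
    then show ?thesis
      using \<kappa>0[of "\<bar>Im k\<bar>"] K3[of "\<bar>Im k\<bar>"] unfolding g_def
      by (cases "\<kappa>0 \<le> \<bar>Im k\<bar>") auto
  qed
  have "g constant_on UNIV"
  proof (rule entire_bounded_on_axes_constant[OF g _ \<open>B \<ge> 0\<close>])
    fix w
    have "K2 * exp (B * \<bar>Im w\<bar>) \<le> K2 * exp (B * norm w)"
      using \<open>K2 \<ge> 0\<close> \<open>B \<ge> 0\<close> abs_Im_le_cmod by (intro mult_left_mono) (auto intro: mult_left_mono)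
    then show "norm (g w) \<le> K2 * exp (B * norm w)" using gK[of w] by linarith
    show "norm (g w) \<le> max K2 (max 1 K3)" if "Re w = 0 \<or> Im w = 0"
      using that imag[of w] gK[of w] by auto
  qed
  then obtain C where C: "\<And>k. g k = C" by (auto simp: constant_on_def)
  have "F (- (of_real \<kappa>)\<^sup>2) = C" for \<kappa> :: real
    using C[of "\<i> * of_real \<kappa>"] by (simp add: g_def power_mult_distrib)
  then have "C = 0" using lim by (simp add: tendsto_const_iff)
  then show ?thesis using C[of "csqrt z"] by (simp add: g_def)
qed

subsection \<open>Weyl solutions\<close>

text \<open>
  The function \<open>u' \<bullet> u - w |u|\<^sup>2\<close> is nondecreasing: the derivative of \<open>w\<close> absorbs the negative part of
  \<open>q\<close>, which need not be bounded, at the price of a bounded error that \<open>\<kappa>\<^sup>2\<close> dominates.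
\<close>

lemma energy_estimate:
  assumes u: "ode_sol q (- (of_real \<kappa>)\<^sup>2) Y u u'" and w: "is_primitive w w' Y"
    and wS: "\<And>x. x \<in> {0..Y} \<Longrightarrow> 0 \<le> w x" "\<And>x. x \<in> {0..Y} \<Longrightarrow> w x \<le> S"
    and w': "\<And>x. x \<in> {0..Y} \<Longrightarrow> w' x \<le> S - max (- q x) 0"
    and \<kappa>: "S + S\<^sup>2 \<le> \<kappa>\<^sup>2"
    and end_pt: "u' Y \<bullet> u Y \<le> w Y * (norm (u Y))\<^sup>2"
    and x: "x \<in> {0..Y}"
  shows "u' x \<bullet> u x \<le> S * (norm (u x))\<^sup>2"
proof -
  let ?p = "\<lambda>x. (of_real (q x) - (- (of_real \<kappa>)\<^sup>2)) * u x :: complex"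
  let ?F' = "\<lambda>x. (?p x \<bullet> u x + u' x \<bullet> u' x)
       - (w' x * (u x \<bullet> u x) + w x * (u' x \<bullet> u x + u x \<bullet> u' x))"
  have F: "is_primitive (\<lambda>x. u' x \<bullet> u x - w x * (u x \<bullet> u x)) ?F' Y"
    using u unfolding ode_sol_def
    by (elim conjE) (intro is_primitive_minus is_primitive_inner is_primitive_mult w)
  have nonneg: "0 \<le> ?F' t" if t: "t \<in> {0..Y}" for t
  proof -
    have p: "?p t = (q t + \<kappa>\<^sup>2) *\<^sub>R u t"
      by (simp add: scaleR_conv_of_real)
    define A B I where "A = norm (u t)" and "B = norm (u' t)" and "I = u' t \<bullet> u t"
    have I: "\<bar>I\<bar> \<le> B * A" unfolding I_def A_def B_def by (rule Cauchy_Schwarz_ineq2)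
    \<comment> \<open>Completing the square bounds \<open>2 * w t * I\<close> by
      \<open>B\<^sup>2 + S\<^sup>2 * A\<^sup>2\<close>, the difference \<open>w' t - q t\<close> is
      at most \<open>S\<close>, and the hypothesis on \<open>\<kappa>\<close> pays for the resulting
      \<open>(S + S\<^sup>2) * A\<^sup>2\<close>.\<close>
    have "2 * w t * I \<le> 2 * S * (B * A)"
    proof -
      have "w t * I \<le> w t * \<bar>I\<bar>" using wS[OF t] by (intro mult_left_mono) auto
      also have "\<dots> \<le> S * (B * A)"
        using wS[OF t] I by (intro mult_mono) (auto simp: A_def B_def)
      finally show ?thesis by simp
    qed
    moreover have "0 \<le> (B - S * A)\<^sup>2" by simp
    moreover have "(w' t - q t) * A\<^sup>2 \<le> S * A\<^sup>2"
      using w'[OF t] by (intro mult_right_mono) auto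
    moreover have "(S + S\<^sup>2) * A\<^sup>2 \<le> \<kappa>\<^sup>2 * A\<^sup>2"
      using \<kappa> by (intro mult_right_mono) auto
    ultimately have "0 \<le> (q t + \<kappa>\<^sup>2) * A\<^sup>2 + B\<^sup>2 - (w' t * A\<^sup>2 + 2 * w t * I)"
      by (simp add: power2_eq_square algebra_simps)
    then show ?thesis
      unfolding p by (simp add: A_def B_def I_def power2_norm_eq_inner inner_commute algebra_simps)
  qed
  have "0 \<le> integral {x..Y} ?F'"
    using nonneg x is_primitive_subinterval(2)[OF F, of x Y]
    by (intro Henstock_Kurzweil_Integration.integral_nonneg) auto
  then have "u' x \<bullet> u x - w x * (u x \<bullet> u x) \<le> u' Y \<bullet> u Y - w Y * (u Y \<bullet> u Y)"
    using is_primitive_diff[OF F, of x Y] x by auto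
  also have "\<dots> \<le> 0" using end_pt by (simp add: power2_norm_eq_inner)
  finally have "u' x \<bullet> u x \<le> w x * (norm (u x))\<^sup>2" by (simp add: power2_norm_eq_inner)
  also have "\<dots> \<le> S * (norm (u x))\<^sup>2" using wS[OF x] by (intro mult_right_mono) auto
  finally show ?thesis .
qed

lemma schroedinger_solution_ode_sol:
  assumes u: "schroedinger_solution q b z u" and c: "0 < c" "ereal c \<le> b"
  shows "ode_sol q z c u (sol_deriv b u)"
proof -
  have sub: "{0..c} \<subseteq> sol_dom b"
    using c by (auto simp: sol_dom_def) (meson ereal_less_eq(3) order_trans)
  obtain u'' where u'': "\<And>x. x \<in> sol_dom b \<Longrightarrow> u'' absolutely_integrable_on {0..x}"
    "\<And>x. x \<in> sol_dom b \<Longrightarrow> sol_deriv b u x = sol_deriv b u 0 + integral {0..x} u''"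
    and ae: "AE x in lebesgue. 0 < x \<and> ereal x < b \<longrightarrow> - u'' x + of_real (q x) * u x = z * u x"
    using u unfolding schroedinger_solution_def by blast
  have prim: "is_primitive (sol_deriv b u) u'' c"
    using sub c by (intro is_primitiveI u'') auto
  have "is_primitive u (sol_deriv b u) c"
  proof (rule is_primitiveI_C1)
    show "(u has_vector_derivative sol_deriv b u x) (at x within {0..c})" if "x \<in> {0..c}" for x
      using u that sub unfolding schroedinger_solution_def sol_deriv_def
      by (meson has_vector_derivative_within_subset subsetD vector_derivative_works)
  qed (rule is_primitive_continuous_on[OF prim])
  moreover have "is_primitive (sol_deriv b u) (\<lambda>x. (of_real (q x) - z) * u x) c"
  proof (rule is_primitive_cong[OF prim])
    \<comment> \<open>The equation is given only on the open interval and \<open>c\<close> may equal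
      \<open>b\<close>; the end points form a null set.\<close>
    have "AE x in lebesgue. x \<noteq> 0 \<and> x \<noteq> (c :: real)"
      using negligible_finite[of "{0, c}"]
      by (simp add: negligible_iff_null_sets completion.AE_iff_null_sets)
    with ae show "AE x in lebesgue. x \<in> {0..c} \<longrightarrow> (of_real (q x) - z) * u x = u'' x"
    proof eventually_elim
      case (elim x)
      show ?case
      proof
        assume "x \<in> {0..c}"
        then have "0 < x" "ereal x < ereal c" using elim(2) by auto
        then have "- u'' x + of_real (q x) * u x = z * u x"
          using elim(1) c(2) by (meson less_le_trans)
        then show "(of_real (q x) - z) * u x = u'' x" by (simp add: algebra_simps)
      qed
    qed
  qed simp
  ultimately show ?thesis by (simp add: ode_sol_def)
qed

text \<open>For \<open>b = \<infinity>\<close> integrability is given on unit intervals, which are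
  glued together.\<close>

lemma is_potential_absolutely_integrable:
  assumes "is_potential q b h" "0 < c" "ereal c \<le> b"
  shows "q absolutely_integrable_on {0..c}"
proof (cases "b = \<infinity>")
  case True
  have unit: "q absolutely_integrable_on {real n..real n + 1}" for n
    using assms(1) True by (auto simp: is_potential_def absolutely_integrable_on_Icc_iff_Ioo)
  have "q absolutely_integrable_on {0..real n}" for n
  proof (induction n)
    case 0
    show ?case by (simp add: absolutely_integrable_negligible)
  next
    case (Suc n)
    show ?case
      using absolutely_integrable_on_combine[OF Suc unit[of n]] by (simp add: add.commute)
  qed
  moreover obtain n where "c \<le> real n" using real_arch_simple by blast
  ultimately show ?thesis
    by (meson absolutely_integrable_on_subinterval atLeastatMost_subset_iff order_refl)
next
  case False
  then obtain \<beta> where b: "b = ereal \<beta>" using assms by (cases b) auto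
  have "{x. 0 < x \<and> ereal x < b} = {0<..<\<beta>}" by (auto simp: b)
  then have "q absolutely_integrable_on {0..\<beta>}"
    using assms(1) b by (simp add: is_potential_def absolutely_integrable_on_Icc_iff_Ioo)
  then show ?thesis
    using absolutely_integrable_on_subinterval[of "{0..\<beta>}" q 0 c] assms b by auto
qed

lemma negative_part_absolutely_integrable:
  fixes q :: "real \<Rightarrow> real"
  assumes "q absolutely_integrable_on S"
  shows "(\<lambda>x. max (- q x) 0) absolutely_integrable_on S"
  using absolutely_integrable_linear[OF assms bounded_linear_minus[OF bounded_linear_ident]]
  by (intro absolutely_integrable_max_1) (auto simp: o_def)

section \<open>Energy bounds for Weyl solutions at finite and infinite right end points\<close>

text \<open>The energy estimate is applied with the weight \<open>S - P\<close>, whose derivative is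
  minus the negative part of \<open>q\<close>. The weight falls from \<open>S\<close> at 0 to
  \<open>hm\<close> at \<open>\<beta>\<close>, just enough to absorb the boundary condition.\<close>

lemma weyl_estimate_finite:
  assumes pot: "is_potential q (ereal \<beta>) h"
  shows "\<exists>S. \<forall>\<kappa> u x. S + S\<^sup>2 \<le> \<kappa>\<^sup>2 \<longrightarrow> is_weyl_solution q (ereal \<beta>) h (- (of_real \<kappa>)\<^sup>2) u \<longrightarrow> x \<in> {0..\<beta>} \<longrightarrow>
     sol_deriv (ereal \<beta>) u x \<bullet> u x \<le> S * (norm (u x))\<^sup>2"
proof -
  have \<beta>: "0 < \<beta>" using pot by (simp add: is_potential_def)
  define qm where "qm = (\<lambda>x. max (- q x) 0)"
  \<comment> \<open>Under the Dirichlet condition \<open>u' \<bullet> u\<close> vanishes at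
    \<open>\<beta>\<close>; otherwise it equals \<open>- h\<close> times the squared norm of
    \<open>u\<close>, so the negative part of \<open>h\<close> has to be absorbed.\<close>
  define hm where "hm = (if h = \<infinity> then 0 else max (- real_of_ereal h) 0)"
  define P where "P = (\<lambda>x. integral {0..x} qm)"
  have qm: "qm absolutely_integrable_on {0..\<beta>}"
    unfolding qm_def using is_potential_absolutely_integrable[OF pot \<beta>]
    by (intro negative_part_absolutely_integrable) auto
  have P: "is_primitive P qm \<beta>"
    unfolding P_def using is_primitive_integral[OF qm, of 0] by simp
  have Pmono: "P x \<le> P y" if "0 \<le> x" "x \<le> y" "y \<le> \<beta>" for x y
    using is_primitive_diff[OF P that] integral_nonneg_total[of "{x..y}" qm] by (simp add: qm_def)
  have P0: "P 0 = 0" by (simp add: P_def)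
  define S where "S = P \<beta> + hm"
  have "hm \<ge> 0" by (simp add: hm_def)
  have w: "is_primitive (\<lambda>x. S - P x) (\<lambda>x. 0 - qm x) \<beta>"
    by (intro is_primitive_minus is_primitive_const P)
  have "S \<ge> 0" using Pmono[of 0 \<beta>] P0 \<beta> \<open>hm \<ge> 0\<close> by (simp add: S_def)
  show ?thesis
  proof (intro exI[of _ S] allI impI)
    fix \<kappa> u x
    assume \<kappa>: "S + S\<^sup>2 \<le> \<kappa>\<^sup>2" and u: "is_weyl_solution q (ereal \<beta>) h (- (of_real \<kappa>)\<^sup>2) u" and x: "x \<in> {0..\<beta>}"
    define u' where "u' = sol_deriv (ereal \<beta>) u"
    have sol: "ode_sol q (- (of_real \<kappa>)\<^sup>2) \<beta> u u'"
      using u schroedinger_solution_ode_sol[of q "ereal \<beta>" _ u \<beta>] \<beta> by (simp add: is_weyl_solution_def u'_def)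
    have "u' \<beta> \<bullet> u \<beta> \<le> hm * (norm (u \<beta>))\<^sup>2"
    proof (cases "h = \<infinity>")
      case True
      then show ?thesis using u by (simp add: is_weyl_solution_def boundary_condition_def)
    next
      case False
      then have "u' \<beta> = (- real_of_ereal h) *\<^sub>R u \<beta>"
        using u by (simp add: is_weyl_solution_def boundary_condition_def u'_def scaleR_conv_of_real eq_neg_iff_add_eq_0)
      then have "u' \<beta> \<bullet> u \<beta> = (- real_of_ereal h) * (norm (u \<beta>))\<^sup>2"
        by (simp add: power2_norm_eq_inner)
      also have "\<dots> \<le> hm * (norm (u \<beta>))\<^sup>2"
        using False by (intro mult_right_mono) (auto simp: hm_def)
      finally show ?thesis .
    qed
    then have e: "u' \<beta> \<bullet> u \<beta> \<le> (S - P \<beta>) * (norm (u \<beta>))\<^sup>2" by (simp add: S_def)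
    show "sol_deriv (ereal \<beta>) u x \<bullet> u x \<le> S * (norm (u x))\<^sup>2"
      unfolding u'_def[symmetric]
    proof (rule energy_estimate[OF sol w _ _ _ \<kappa> e x])
      fix t assume "t \<in> {0..\<beta>}"
      then show "0 \<le> S - P t" "S - P t \<le> S" "0 - qm t \<le> S - max (- q t) 0"
        using Pmono[of t \<beta>] Pmono[of 0 t] P0 \<open>hm \<ge> 0\<close> \<open>S \<ge> 0\<close> by (auto simp: S_def qm_def)
    qed
  qed
qed

text \<open>Differentiates the averaged part of the weight that is used on the half line.\<close>

lemma has_vector_derivative_moving_integral:
  fixes P :: "real \<Rightarrow> real"
  assumes "continuous_on {0..c + 1} P" and x: "x \<in> {0..c}"
  shows "((\<lambda>t. integral {t..t + 1} P) has_vector_derivative (P (x + 1) - P x)) (at x within {0..c})"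
proof -
  define V where "V = (\<lambda>t. integral {0..t} P)"
  have V: "(V has_vector_derivative P t) (at t within {0..c + 1})" if "t \<in> {0..c + 1}" for t
    unfolding V_def using assms(1) that by (rule integral_has_vector_derivative)
  have "((V \<circ> (\<lambda>t. t + 1)) has_vector_derivative (1 *\<^sub>R P (x + 1))) (at x within {0..c})"
  proof (rule vector_diff_chain_within)
    show "((\<lambda>t. t + 1) has_vector_derivative 1) (at x within {0..c})"
      by (auto intro!: derivative_eq_intros)
    show "(V has_vector_derivative P (x + 1)) (at (x + 1) within (\<lambda>t. t + 1) ` {0..c})"
      by (rule has_vector_derivative_within_subset[OF V]) (use x in auto)
  qed
  moreover have "(V has_vector_derivative P x) (at x within {0..c})"
    by (rule has_vector_derivative_within_subset[OF V]) (use x in auto)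
  ultimately have "((\<lambda>t. V (t + 1) - V t) has_vector_derivative (P (x + 1) - P x)) (at x within {0..c})"
    by (auto simp: o_def intro: has_vector_derivative_diff)
  then show ?thesis
  proof (rule has_vector_derivative_transform[OF x, rotated])
    fix t assume t: "t \<in> {0..c}"
    have "P integrable_on {0..t + 1}"
      using t by (intro integrable_continuous_real continuous_on_subset[OF assms(1)]) auto
    then have "integral {0..t} P + integral {t..t + 1} P = integral {0..t + 1} P"
      using t by (intro Henstock_Kurzweil_Integration.integral_combine) auto
    then show "integral {t..t + 1} P = V (t + 1) - V t" by (simp add: V_def)
  qed
qed

text \<open>Otherwise \<open>(norm (u y))\<^sup>2\<close>, a primitive of
  \<open>2 * (u' y \<bullet> u y)\<close>, would be nondecreasing and positive beyond some point,
  which contradicts its integrability.\<close>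

lemma L2_derivative_nonpos:
  assumes L2: "L2_at_infinity u"
    and u: "\<And>c. 0 < c \<Longrightarrow> is_primitive u u' c"
  shows "\<exists>y\<ge>c. u' y \<bullet> u y \<le> 0"
proof (rule ccontr)
  assume "\<not> ?thesis"
  then have pos: "0 < u' y \<bullet> u y" if "y \<ge> c" for y
    using that by force
  obtain c0 where "c0 \<ge> 0" and int: "(\<lambda>x. (norm (u x))\<^sup>2) absolutely_integrable_on {c0..}"
    using L2 unfolding L2_at_infinity_def by blast
  define d where "d = max c c0"
  have d: "d \<ge> 0" "d \<ge> c" "d \<ge> c0" using \<open>c0 \<ge> 0\<close> by (auto simp: d_def)
  define \<delta> where "\<delta> = (norm (u d))\<^sup>2"
  have "u d \<noteq> 0" using pos[OF d(2)] by auto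
  then have "\<delta> > 0" by (simp add: \<delta>_def)
  have ge: "\<delta> \<le> (norm (u y))\<^sup>2" if y: "y \<ge> d" for y
  proof -
    have p: "is_primitive u u' (y + 1)" using u d y by simp
    note F = is_primitive_inner[OF p p]
    have "0 \<le> integral {d..y} (\<lambda>x. u' x \<bullet> u x + u x \<bullet> u' x)"
      by (rule integral_nonneg_total) (use pos d in \<open>auto simp: inner_commute less_imp_le\<close>)
    then show ?thesis
      using is_primitive_diff[OF F, of d y] d y by (simp add: \<delta>_def power2_norm_eq_inner)
  qed
  define I where "I = integral {c0..} (\<lambda>x. (norm (u x))\<^sup>2)"
  have "real n * \<delta> \<le> I" for n
  proof -
    have i1: "(\<lambda>x. (norm (u x))\<^sup>2) integrable_on {c0..}"
      using int by (simp add: absolutely_integrable_on_def)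
    have i2: "(\<lambda>x. (norm (u x))\<^sup>2) integrable_on {d..d + real n}"
      by (rule integrable_on_subinterval[OF i1]) (use d in auto)
    have "integral {d..d + real n} (\<lambda>x. \<delta>) \<le> integral {d..d + real n} (\<lambda>x. (norm (u x))\<^sup>2)"
      using ge by (intro integral_le i2) auto
    also have "\<dots> \<le> I"
      unfolding I_def using d by (intro integral_subset_le i1 i2) auto
    finally show ?thesis by simp
  qed
  moreover obtain n where "I / \<delta> < real n" using reals_Archimedean2 by blast
  ultimately show False using \<open>\<delta> > 0\<close> by (metis pos_divide_less_eq not_less)
qed

lemma weyl_estimate_infinite:
  assumes pot: "is_potential q \<infinity> h" and "0 < c"
  shows "\<exists>S. \<forall>\<kappa> u x. S + S\<^sup>2 \<le> \<kappa>\<^sup>2 \<longrightarrow> is_weyl_solution q \<infinity> h (- (of_real \<kappa>)\<^sup>2) u \<longrightarrow> x \<in> {0..c} \<longrightarrow>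
     sol_deriv \<infinity> u x \<bullet> u x \<le> S * (norm (u x))\<^sup>2"
proof -
  define qm where "qm = (\<lambda>x. max (- q x) 0)"
  define P where "P = (\<lambda>x. integral {0..x} qm)"
  have qm: "qm absolutely_integrable_on {0..Y}" if "0 < Y" for Y
    unfolding qm_def using is_potential_absolutely_integrable[OF pot that]
    by (intro negative_part_absolutely_integrable) auto
  have P: "is_primitive P qm Y" if "0 < Y" for Y
    unfolding P_def using is_primitive_integral[OF qm[OF that], of 0] by simp
  have Pdiff: "P y - P x = integral {x..y} qm" if "0 \<le> x" "x \<le> y" for x y
    using is_primitive_diff[OF P[of "y + 1"], of x y] that by simp
  have Pmono: "P x \<le> P y" if "0 \<le> x" "x \<le> y" for x y
    using Pdiff[OF that] integral_nonneg_total[of "{x..y}" qm] by (simp add: qm_def)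
  have P0: "P 0 = 0" by (simp add: P_def)
  have "bdd_above ((\<lambda>y. integral {y<..<y + 1} qm) ` {0<..})"
    using pot by (simp add: is_potential_def qm_def)
  then obtain S0 where S0: "\<And>y. y > 0 \<Longrightarrow> integral {y<..<y + 1} qm \<le> S0"
    unfolding bdd_above_def by auto
  \<comment> \<open>\<open>P 1\<close> covers the window that starts at 0, which the supremum over
    positive \<open>y\<close> does not include.\<close>
  define S where "S = max S0 (P 1)"
  have "S \<ge> 0" using Pmono[of 0 1] P0 by (simp add: S_def)
  have PS: "P (t + 1) - P t \<le> S" if "0 \<le> t" for t
  proof (cases "t = 0")
    case False
    then show ?thesis
      using S0[of t] Pdiff[of t "t + 1"] that by (simp add: S_def integral_open_interval_real)
  qed (simp add: S_def P0)
  \<comment> \<open>subtracting \<open>P\<close> from its average over the next unit interval keeps \<open>w\<close> bounded\<close>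
  define w where "w = (\<lambda>t. integral {t..t + 1} P - P t)"
  have w: "is_primitive w (\<lambda>t. (P (t + 1) - P t) - qm t) Y" if "0 < Y" for Y
    unfolding w_def
  proof (intro is_primitive_minus P that)
    have cont: "continuous_on {0..Y + 1} P"
      using is_primitive_continuous_on[OF P[of "Y + 1"]] that by simp
    show "is_primitive (\<lambda>t. integral {t..t + 1} P) (\<lambda>t. P (t + 1) - P t) Y"
    proof (rule is_primitiveI_C1[OF has_vector_derivative_moving_integral[OF cont]])
      show "continuous_on {0..Y} (\<lambda>t. P (t + 1) - P t)"
        by (intro continuous_intros continuous_on_compose2[OF cont] continuous_on_subset[OF cont]) auto
    qed
  qed
  have w0: "0 \<le> w t" and wS: "w t \<le> S" if t: "0 \<le> t" for t
  proof -
    have i: "P integrable_on {t..t + 1}"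
      using is_primitive_continuous_on[OF P[of "t + 1"]] t
      by (intro integrable_continuous_real) (auto intro: continuous_on_subset)
    have "integral {t..t + 1} (\<lambda>_. P t) \<le> integral {t..t + 1} P"
      by (rule integral_le[OF integrable_const_ivl i]) (use Pmono t in auto)
    moreover have "integral {t..t + 1} P \<le> integral {t..t + 1} (\<lambda>_. P (t + 1))"
      by (rule integral_le[OF i integrable_const_ivl]) (use Pmono t in auto)
    ultimately show "0 \<le> w t" "w t \<le> S"
      using PS[OF t] by (auto simp: w_def)
  qed
  show ?thesis
  proof (intro exI[of _ S] allI impI)
    fix \<kappa> u x
    assume \<kappa>: "S + S\<^sup>2 \<le> \<kappa>\<^sup>2" and u: "is_weyl_solution q \<infinity> h (- (of_real \<kappa>)\<^sup>2) u" and x: "x \<in> {0..c}"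
    define u' where "u' = sol_deriv \<infinity> u"
    have sol: "ode_sol q (- (of_real \<kappa>)\<^sup>2) Y u u'" if "0 < Y" for Y
      using u schroedinger_solution_ode_sol[of q \<infinity> _ u Y] that by (simp add: is_weyl_solution_def u'_def)
    have "L2_at_infinity u" using u by (simp add: is_weyl_solution_def)
    \<comment> \<open>\<open>Y\<close> may depend on \<open>\<kappa>\<close> and \<open>u\<close>,
      but the bound \<open>S\<close> does not.\<close>
    then obtain Y where Y: "Y \<ge> c" "u' Y \<bullet> u Y \<le> 0"
      using L2_derivative_nonpos[of u u' c] sol by (auto simp: ode_sol_def)
    have "Y > 0" using Y \<open>0 < c\<close> by simp
    have e: "u' Y \<bullet> u Y \<le> w Y * (norm (u Y))\<^sup>2"
      using Y(2) w0[of Y] \<open>Y > 0\<close> by (meson less_imp_le mult_nonneg_nonneg order_trans zero_le_power2)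
    have xY: "x \<in> {0..Y}" using x Y by auto
    show "sol_deriv \<infinity> u x \<bullet> u x \<le> S * (norm (u x))\<^sup>2"
      unfolding u'_def[symmetric]
    proof (rule energy_estimate[OF sol[OF \<open>Y > 0\<close>] w[OF \<open>Y > 0\<close>] _ _ _ \<kappa> e xY])
      fix t assume "t \<in> {0..Y}"
      then show "0 \<le> w t" "w t \<le> S" "P (t + 1) - P t - qm t \<le> S - max (- q t) 0"
        using w0 wS PS[of t] by (auto simp: qm_def)
    qed
  qed
qed

lemma weyl_estimate:
  assumes pot: "is_potential q b h" and c: "0 < c" "ereal c \<le> b"
  shows "\<exists>S. \<forall>\<kappa> u x. S + S\<^sup>2 \<le> \<kappa>\<^sup>2 \<longrightarrow> is_weyl_solution q b h (- (of_real \<kappa>)\<^sup>2) u \<longrightarrow> x \<in> {0..c} \<longrightarrow>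
     sol_deriv b u x \<bullet> u x \<le> S * (norm (u x))\<^sup>2"
proof (cases "b = \<infinity>")
  case True
  then show ?thesis using weyl_estimate_infinite pot c(1) by blast
next
  case False
  then obtain \<beta> where b: "b = ereal \<beta>" using c by (cases b) auto
  then have "c \<le> \<beta>" using c by simp
  obtain S where "\<forall>\<kappa> u x. S + S\<^sup>2 \<le> \<kappa>\<^sup>2 \<longrightarrow> is_weyl_solution q (ereal \<beta>) h (- (of_real \<kappa>)\<^sup>2) u \<longrightarrow> x \<in> {0..\<beta>} \<longrightarrow>
     sol_deriv (ereal \<beta>) u x \<bullet> u x \<le> S * (norm (u x))\<^sup>2"
    using weyl_estimate_finite pot b by blast
  then show ?thesis
    unfolding b using \<open>c \<le> \<beta>\<close> by (intro exI[of _ S]) auto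
qed

section \<open>Consequences of the asymptotics that define the A-function\<close>

text \<open>The Laplace integral is bounded by the integral of
  \<open>\<bar>A \<alpha>\<bar>\<close>, and the remainder tends to 0.\<close>

lemma is_A_function_m_asymptotics:
  assumes A: "is_A_function q b h A" and a: "0 < a" "ereal a \<le> b"
  shows "\<exists>C \<kappa>0. \<forall>\<kappa>\<ge>\<kappa>0. norm (m_function q b h (- (of_real \<kappa>)\<^sup>2) + of_real \<kappa>) \<le> C"
proof -
  define E where "E = (\<lambda>\<kappa>. integral {0<..<a} (\<lambda>\<alpha>. A \<alpha> * exp (- 2 * \<alpha> * \<kappa>)))"
  define R where "R = (\<lambda>\<kappa>. m_function q b h (- (of_real \<kappa>)\<^sup>2) - (- of_real \<kappa> - of_real (E \<kappa>)))"
  have A': "A absolutely_integrable_on {0<..<a}" "soft_O at_top R (\<lambda>\<kappa>. exp (- 2 * a * \<kappa>))"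
    using A a unfolding is_A_function_def R_def E_def by auto
  \<comment> \<open>With \<open>\<epsilon> = 1\<close> the exponent of the comparison function is 0,
    so the remainder itself tends to 0.\<close>
  have "((\<lambda>\<kappa>. norm (R \<kappa>) / \<bar>exp (- 2 * a * \<kappa>)\<bar> powr (1 - 1)) \<longlongrightarrow> 0) at_top"
    using A'(2) unfolding soft_O_def by (elim conjE allE[of _ 1]) simp
  then have "((\<lambda>\<kappa>. norm (R \<kappa>)) \<longlongrightarrow> 0) at_top" by simp
  then have "eventually (\<lambda>\<kappa>. norm (R \<kappa>) < 1) at_top"
    by (rule order_tendstoD(2)) simp
  then obtain \<kappa>0 where \<kappa>0: "\<And>\<kappa>. \<kappa> \<ge> \<kappa>0 \<Longrightarrow> norm (R \<kappa>) < 1"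
    by (auto simp: eventually_at_top_linorder)
  have E: "\<bar>E \<kappa>\<bar> \<le> integral {0<..<a} (\<lambda>\<alpha>. \<bar>A \<alpha>\<bar>)" if "\<kappa> \<ge> 0" for \<kappa>
  proof -
    have le: "\<bar>A \<alpha> * exp (- 2 * \<alpha> * \<kappa>)\<bar> \<le> \<bar>A \<alpha>\<bar>" if "\<alpha> \<in> {0<..<a}" for \<alpha>
      using that \<open>\<kappa> \<ge> 0\<close> by (auto simp: abs_mult intro!: mult_left_le)
    have "(\<lambda>\<alpha>. \<bar>A \<alpha>\<bar>) integrable_on {0<..<a}"
      using A'(1) by (simp add: absolutely_integrable_on_def)
    moreover have "(\<lambda>\<alpha>. exp (- 2 * \<alpha> * \<kappa>) * A \<alpha>) integrable_on {0..a}"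
      using A'(1) unfolding absolutely_integrable_on_Icc_iff_Ioo[symmetric]
      by (intro absolutely_integrable_bilinear_continuous(2)[OF bounded_bilinear_mult] continuous_intros)
    then have "(\<lambda>\<alpha>. A \<alpha> * exp (- 2 * \<alpha> * \<kappa>)) integrable_on {0<..<a}"
      by (simp add: integrable_on_Icc_iff_Ioo mult.commute)
    ultimately have "norm (E \<kappa>) \<le> integral {0<..<a} (\<lambda>\<alpha>. \<bar>A \<alpha>\<bar>)"
      unfolding E_def using le by (intro integral_norm_bound_integral) auto
    then show ?thesis by simp
  qed
  show ?thesis
  proof (intro exI allI impI)
    fix \<kappa> assume \<kappa>: "max 0 \<kappa>0 \<le> \<kappa>"
    have "m_function q b h (- (of_real \<kappa>)\<^sup>2) + of_real \<kappa> = R \<kappa> - of_real (E \<kappa>)"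
      by (simp add: R_def)
    also have "norm \<dots> \<le> norm (R \<kappa>) + \<bar>E \<kappa>\<bar>"
      using norm_triangle_ineq4[of "R \<kappa>" "of_real (E \<kappa>)"] by simp
    also have "\<dots> \<le> 1 + integral {0<..<a} (\<lambda>\<alpha>. \<bar>A \<alpha>\<bar>)"
      using \<kappa>0[of \<kappa>] E[of \<kappa>] \<kappa> by simp
    finally show "norm (m_function q b h (- (of_real \<kappa>)\<^sup>2) + of_real \<kappa>) \<le> 1 + integral {0<..<a} (\<lambda>\<alpha>. \<bar>A \<alpha>\<bar>)" .
  qed
qed

text \<open>
  Existence comes for free: without a Weyl solution, the choice in \<open>weyl_solution\<close> would return a
  function that does not depend on \<open>\<kappa>\<close>, and if the Weyl solution vanished at \<open>0\<close>, then \<open>m = 0\<close> because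
  division by zero gives zero. Both contradict \<open>m = -\<kappa> + O(1)\<close>.
\<close>

lemma is_A_function_weyl_solution:
  assumes A: "is_A_function q b h A" and a: "0 < a" "ereal a \<le> b"
  shows "eventually (\<lambda>\<kappa>. is_weyl_solution q b h (- (of_real \<kappa>)\<^sup>2) (weyl_solution q b h (- (of_real \<kappa>)\<^sup>2))
     \<and> weyl_solution q b h (- (of_real \<kappa>)\<^sup>2) 0 \<noteq> 0) at_top"
proof -
  obtain C \<kappa>0 where C: "\<And>\<kappa>. \<kappa> \<ge> \<kappa>0 \<Longrightarrow> norm (m_function q b h (- (of_real \<kappa>)\<^sup>2) + of_real \<kappa>) \<le> C"
    using is_A_function_m_asymptotics[OF assms] by blast
  \<comment> \<open>The value of the choice operator at the empty predicate, the same for every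
    \<open>\<kappa>\<close>.\<close>
  define v where "v = (SOME u :: real \<Rightarrow> complex. False)"
  define m0 where "m0 = norm (sol_deriv b v 0 / v 0)"
  \<comment> \<open>Beyond \<open>C + m0\<close> the modulus of \<open>m\<close> exceeds
    \<open>m0\<close>, which rules out both the default choice and \<open>m = 0\<close>.\<close>
  have "eventually (\<lambda>\<kappa>. \<kappa> > max \<kappa>0 (C + m0)) at_top" by (rule eventually_gt_at_top)
  then show ?thesis
  proof eventually_elim
    case (elim \<kappa>)
    let ?z = "- (of_real \<kappa>)\<^sup>2 :: complex" and ?m = "m_function q b h (- (of_real \<kappa>)\<^sup>2)"
    have "m0 \<ge> 0" by (simp add: m0_def)
    have "\<kappa> \<le> \<bar>\<kappa>\<bar>" by simp
    also have "\<dots> = norm ((?m + of_real \<kappa>) - ?m)" by simp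
    also have "\<dots> \<le> C + norm ?m"
      using norm_triangle_ineq4[of "?m + of_real \<kappa>" ?m] C[of \<kappa>] elim by simp
    finally have big: "m0 < norm ?m" using elim by simp
    have ex: "\<exists>u. is_weyl_solution q b h ?z u"
    proof (rule ccontr)
      assume "\<not> ?thesis"
      then have "weyl_solution q b h ?z = v" by (simp add: weyl_solution_def v_def)
      then show False using big by (simp add: m_function_def m0_def)
    qed
    then have "is_weyl_solution q b h ?z (weyl_solution q b h ?z)"
      unfolding weyl_solution_def by (rule someI_ex)
    moreover have "weyl_solution q b h ?z 0 \<noteq> 0"
      using big \<open>m0 \<ge> 0\<close> by (auto simp: m_function_def)
    ultimately show ?case by blast
  qed
qed

text \<open>\<open>\<theta> + m * \<phi>\<close> is the Weyl solution divided by its value at 0.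
  After this division the initial term of the decay estimate is \<open>m - \<kappa>\<close>, of
  modulus at most \<open>3 * \<kappa>\<close>; the factor \<open>2 / \<kappa>\<close> turns this
  into the constant 6.\<close>

lemma weyl_solution_decay:
  assumes fs: "fundamental_system q a \<theta> \<theta>' \<phi> \<phi>'" and pot: "is_potential q b h"
    and A: "is_A_function q b h A" and a: "0 < a" "ereal a \<le> b"
  shows "\<exists>K. eventually (\<lambda>\<kappa>. \<forall>x\<in>{0..a}.
     norm (\<theta> (- (of_real \<kappa>)\<^sup>2) x + m_function q b h (- (of_real \<kappa>)\<^sup>2) * \<phi> (- (of_real \<kappa>)\<^sup>2) x) \<le> K * exp (- \<kappa> * x)) at_top"
proof -
  interpret fundamental_system q a \<theta> \<theta>' \<phi> \<phi>' by fact
  obtain C \<kappa>0 where C: "\<And>\<kappa>. \<kappa> \<ge> \<kappa>0 \<Longrightarrow> norm (m_function q b h (- (of_real \<kappa>)\<^sup>2) + of_real \<kappa>) \<le> C"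
    using is_A_function_m_asymptotics[OF A a] by blast
  obtain S where S: "\<And>\<kappa> u x. S + S\<^sup>2 \<le> \<kappa>\<^sup>2 \<Longrightarrow> is_weyl_solution q b h (- (of_real \<kappa>)\<^sup>2) u \<Longrightarrow> x \<in> {0..a} \<Longrightarrow>
     sol_deriv b u x \<bullet> u x \<le> S * (norm (u x))\<^sup>2"
    using weyl_estimate[OF pot a] by blast
  define Q where "Q = exp (integral {0..a} (\<lambda>t. \<bar>q t\<bar>))"
  have "Q > 0" by (simp add: Q_def)
  have "eventually (\<lambda>\<kappa>. \<kappa> \<ge> \<kappa>0 \<and> \<kappa> \<ge> C \<and> \<kappa> \<ge> 2 \<and> \<kappa> \<ge> 4 * S \<and> \<kappa> \<ge> \<bar>S\<bar> + 1) at_top"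
    by (intro eventually_conj eventually_ge_at_top)
  with is_A_function_weyl_solution[OF A a]
  have "eventually (\<lambda>\<kappa>. \<forall>x\<in>{0..a}.
     norm (\<theta> (- (of_real \<kappa>)\<^sup>2) x + m_function q b h (- (of_real \<kappa>)\<^sup>2) * \<phi> (- (of_real \<kappa>)\<^sup>2) x) \<le> 6 * Q * exp (- \<kappa> * x)) at_top"
  proof eventually_elim
    case (elim \<kappa>)
    define z where "z = (- (of_real \<kappa>)\<^sup>2 :: complex)"
    define u where "u = weyl_solution q b h z"
    define u' where "u' = sol_deriv b u"
    define m where "m = m_function q b h z"
    have m: "m = u' 0 / u 0" by (simp add: m_def m_function_def u_def u'_def)
    have W: "is_weyl_solution q b h z u" and u0: "u 0 \<noteq> 0"
      using elim(1) by (auto simp: u_def z_def)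
    have sol: "ode_sol q z a u u'"
      using W a schroedinger_solution_ode_sol[of q b z u a] by (simp add: is_weyl_solution_def u'_def)
    \<comment> \<open>Thus \<open>\<bar>S\<bar> + 1 \<le> \<kappa>\<close> meets the threshold of
      the energy estimate whatever the sign of \<open>S\<close>.\<close>
    have "S + S\<^sup>2 \<le> (\<bar>S\<bar> + 1)\<^sup>2" by (simp add: power2_eq_square algebra_simps)
    also have "\<dots> \<le> \<kappa>\<^sup>2" using elim(2) by (intro power_mono) auto
    finally have \<kappa>: "S + S\<^sup>2 \<le> \<kappa>\<^sup>2" .
    show ?case
    proof
      fix x assume x: "x \<in> {0..a}"
      have "norm (u x) \<le> 2 / \<kappa> * norm (u' 0 - of_real \<kappa> * u 0) * Q * exp (- \<kappa> * x)"
        unfolding Q_def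
        by (rule ode_sol_decay[OF sol[unfolded z_def] q_integrable _ _ _ x])
          (use S[OF \<kappa> W[unfolded z_def]] elim(2) in \<open>auto simp: u'_def\<close>)
      also have "u' 0 - of_real \<kappa> * u 0 = (m - of_real \<kappa>) * u 0"
        using u0 by (simp add: m algebra_simps)
      also have "2 / \<kappa> * norm ((m - of_real \<kappa>) * u 0) * Q * exp (- \<kappa> * x)
          \<le> 2 / \<kappa> * (3 * \<kappa> * norm (u 0)) * Q * exp (- \<kappa> * x)"
      proof (intro mult_right_mono mult_left_mono)
        have "norm (m - of_real \<kappa>) = norm ((m + of_real \<kappa>) - of_real (2 * \<kappa>))" by simp
        also have "\<dots> \<le> C + 2 * \<kappa>"
          using norm_triangle_ineq4[of "m + of_real \<kappa>" "of_real (2 * \<kappa>)"] C[of \<kappa>] elim(2)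
          by (simp add: m_def z_def norm_mult)
        also have "\<dots> \<le> 3 * \<kappa>" using elim(2) by simp
        finally show "norm ((m - of_real \<kappa>) * u 0) \<le> 3 * \<kappa> * norm (u 0)"
          unfolding norm_mult by (intro mult_right_mono) auto
      qed (use elim(2) \<open>Q > 0\<close> in auto)
      also have "\<dots> = norm (u 0) * (6 * Q * exp (- \<kappa> * x))"
        using elim(2) by simp
      also have "u x = u 0 * (\<theta> z x + m * \<phi> z x)"
        using ode_sol_expansion[OF sol x] u0 by (simp add: m distrib_left)
      finally have "norm (u 0) * norm (\<theta> z x + m * \<phi> z x) \<le> norm (u 0) * (6 * Q * exp (- \<kappa> * x))"
        by (simp add: norm_mult)
      then show "norm (\<theta> (- (of_real \<kappa>)\<^sup>2) x + m_function q b h (- (of_real \<kappa>)\<^sup>2) * \<phi> (- (of_real \<kappa>)\<^sup>2) x) \<le> 6 * Q * exp (- \<kappa> * x)"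
        using u0 by (simp add: m_def z_def)
    qed
  qed
  then show ?thesis by blast
qed

text \<open>The two Laplace integrals agree, so the difference of the m-functions is a difference of
  remainders. These decay faster than \<open>exp (- 2 * x * \<kappa>)\<close> for each fixed
  \<open>x < a\<close>.\<close>

lemma m_function_difference:
  assumes A1: "is_A_function q1 b1 h1 A1" and A2: "is_A_function q2 b2 h2 A2"
    and a: "0 < a" "ereal a \<le> b1" "ereal a \<le> b2"
    and eq: "AE \<alpha> in lebesgue. \<alpha> \<in> {0..a} \<longrightarrow> A1 \<alpha> = A2 \<alpha>"
    and x: "0 < x" "x < a"
  shows "((\<lambda>\<kappa>. norm (m_function q1 b1 h1 (- (of_real \<kappa>)\<^sup>2) - m_function q2 b2 h2 (- (of_real \<kappa>)\<^sup>2))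
     * exp (2 * x * \<kappa>)) \<longlongrightarrow> 0) at_top"
proof -
  define E where "E = (\<lambda>A \<kappa>. integral {0<..<a} (\<lambda>\<alpha>. A \<alpha> * exp (- 2 * \<alpha> * \<kappa>)))"
  define R where "R = (\<lambda>q b h A \<kappa>. m_function q b h (- (of_real \<kappa>)\<^sup>2) - (- of_real \<kappa> - of_real (E A \<kappa>)))"
  have E: "E A1 \<kappa> = E A2 \<kappa>" for \<kappa>
  proof -
    have "negligible {\<alpha>. \<not> (\<alpha> \<in> {0..a} \<longrightarrow> A1 \<alpha> = A2 \<alpha>)}"
      using eq by (simp add: negligible_iff_null_sets completion.AE_iff_null_sets)
    then show ?thesis
      unfolding E_def by (rule integral_spike) auto
  qed
  have lim: "((\<lambda>\<kappa>. norm (R q b h A \<kappa>) * exp (2 * x * \<kappa>)) \<longlongrightarrow> 0) at_top"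
    if "is_A_function q b h A" "ereal a \<le> b" for q b h A
  proof -
    have "soft_O at_top (R q b h A) (\<lambda>\<kappa>. exp (- 2 * a * \<kappa>))"
      using that a(1) unfolding is_A_function_def R_def E_def by auto
    \<comment> \<open>The choice \<open>\<epsilon> = 1 - x / a\<close> turns
      \<open>exp (- 2 * a * \<kappa>)\<close> into \<open>exp (- 2 * x * \<kappa>)\<close>; it is
      positive because \<open>x < a\<close>.\<close>
    then have "((\<lambda>\<kappa>. norm (R q b h A \<kappa>) / \<bar>exp (- 2 * a * \<kappa>)\<bar> powr (1 - (1 - x / a))) \<longlongrightarrow> 0) at_top"
      unfolding soft_O_def using x by (elim conjE allE[of _ "1 - x / a"]) simp
    moreover have "\<bar>exp (- 2 * a * \<kappa>)\<bar> powr (1 - (1 - x / a)) = inverse (exp (2 * x * \<kappa>))" for \<kappa>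
      using a(1) by (simp add: powr_def flip: exp_minus)
    ultimately show ?thesis by (simp add: divide_inverse)
  qed
  have lim2: "((\<lambda>\<kappa>. norm (R q1 b1 h1 A1 \<kappa>) * exp (2 * x * \<kappa>) + norm (R q2 b2 h2 A2 \<kappa>) * exp (2 * x * \<kappa>)) \<longlongrightarrow> 0) at_top"
    using tendsto_add[OF lim[OF A1 a(2)] lim[OF A2 a(3)]] by simp
  show ?thesis
  proof (rule Lim_null_comparison[OF always_eventually lim2], rule allI)
    fix \<kappa>
    have "m_function q1 b1 h1 (- (of_real \<kappa>)\<^sup>2) - m_function q2 b2 h2 (- (of_real \<kappa>)\<^sup>2) = R q1 b1 h1 A1 \<kappa> - R q2 b2 h2 A2 \<kappa>"
      by (simp add: R_def E)
    then have "norm (m_function q1 b1 h1 (- (of_real \<kappa>)\<^sup>2) - m_function q2 b2 h2 (- (of_real \<kappa>)\<^sup>2))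
        \<le> norm (R q1 b1 h1 A1 \<kappa>) + norm (R q2 b2 h2 A2 \<kappa>)"
      by (simp only: norm_triangle_ineq4)
    then show "norm (norm (m_function q1 b1 h1 (- (of_real \<kappa>)\<^sup>2) - m_function q2 b2 h2 (- (of_real \<kappa>)\<^sup>2)) * exp (2 * x * \<kappa>))
        \<le> norm (R q1 b1 h1 A1 \<kappa>) * exp (2 * x * \<kappa>) + norm (R q2 b2 h2 A2 \<kappa>) * exp (2 * x * \<kappa>)"
      by (simp add: mult_right_mono flip: distrib_right)
  qed
qed

subsection \<open>Recovering the potential\<close>

text \<open>Differentiating the equality of squares once gives \<open>y' y = v' v\<close>, and
  differentiating again brings in the potentials. Where \<open>y\<close> is nonzero the squares of
  \<open>y'\<close> and \<open>v'\<close> agree too, so only the potentials are left to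
  compare.\<close>

lemma potentials_eq_AE_where_solution_nonzero:
  assumes y: "ode_sol q1 z c y y'" and v: "ode_sol q2 z c v v'" and "0 < c"
    and sq: "\<And>x. x \<in> {0..c} \<Longrightarrow> y x * y x = v x * v x"
  shows "AE x in lebesgue. x \<in> {0..c} \<longrightarrow> y x \<noteq> 0 \<longrightarrow> q1 x = q2 x"
proof -
  note yp = y[unfolded ode_sol_def, THEN conjunct1] y[unfolded ode_sol_def, THEN conjunct2]
  note vp = v[unfolded ode_sol_def, THEN conjunct1] v[unfolded ode_sol_def, THEN conjunct2]
  note cont = ode_sol_continuous[OF y] ode_sol_continuous[OF v]
  have d1: "(y' x * y x + y x * y' x) - (v' x * v x + v x * v' x) = 0" if "x \<in> {0..c}" for x
  proof (rule is_primitive_zero_continuous[OF _ _ \<open>0 < c\<close> _ that])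
    show "is_primitive (\<lambda>x. y x * y x - v x * v x)
      (\<lambda>x. (y' x * y x + y x * y' x) - (v' x * v x + v x * v' x)) c"
      by (intro is_primitive_minus is_primitive_mult yp vp)
    show "continuous_on {0..c} (\<lambda>x. (y' x * y x + y x * y' x) - (v' x * v x + v x * v' x))"
      by (intro continuous_intros cont)
  qed (simp add: sq)
  \<comment> \<open>\<open>y'\<close> and \<open>v'\<close> are only absolutely continuous, so the
    second differentiation gives an identity almost everywhere.\<close>
  have "AE x in lebesgue. x \<in> {0..c} \<longrightarrow>
    ((of_real (q1 x) - z) * y x * y x + y' x * y' x) - ((of_real (q2 x) - z) * v x * v x + v' x * v' x) = 0"
  proof (rule is_primitive_zero_AE)
    show "is_primitive (\<lambda>x. y' x * y x - v' x * v x)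
      (\<lambda>x. ((of_real (q1 x) - z) * y x * y x + y' x * y' x) - ((of_real (q2 x) - z) * v x * v x + v' x * v' x)) c"
      by (intro is_primitive_minus is_primitive_mult yp vp)
    fix x assume "x \<in> {0..c}"
    then have "2 * (y' x * y x - v' x * v x) = 0" using d1[of x] by (simp add: algebra_simps)
    then show "y' x * y x - v' x * v x = 0" by simp
  qed
  then show ?thesis
  proof eventually_elim
    case (elim x)
    show ?case
    proof (intro impI)
      assume x: "x \<in> {0..c}" and "y x \<noteq> 0"
      have 1: "y' x * y x = v' x * v x"
      proof -
        have "2 * (y' x * y x - v' x * v x) = 0" using d1[OF x] by (simp add: algebra_simps)
        then show ?thesis by simp
      qed
      have "(y' x * y' x - v' x * v' x) * (y x * y x) = (y' x * y x) * (y' x * y x) - v' x * v' x * (v x * v x)"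
        using sq[OF x] by (simp add: algebra_simps)
      also have "\<dots> = 0" unfolding 1 by (simp add: algebra_simps)
      finally have "y' x * y' x = v' x * v' x" using \<open>y x \<noteq> 0\<close> by simp
      then have "(of_real (q1 x) - z) * (y x * y x) = (of_real (q2 x) - z) * (v x * v x)"
        using elim x by (simp add: mult.assoc)
      then show "q1 x = q2 x" using sq[OF x] \<open>y x \<noteq> 0\<close> by auto
    qed
  qed
qed

text \<open>By the Wronskian, \<open>\<phi> / \<theta>\<close> has derivative
  \<open>1 / \<theta>\<^sup>2\<close> and \<open>\<theta> / \<phi>\<close> has derivative
  \<open>- 1 / \<phi>\<^sup>2\<close>, so equal quotients lead to equal squares. As
  \<open>\<theta>\<close> and \<open>\<phi>\<close> have no common zero, one of them detects the
  potential at each point.\<close>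

lemma potentials_eq_AE:
  assumes "fundamental_system q1 c \<theta>1 \<theta>1' \<phi>1 \<phi>1'" "fundamental_system q2 c \<theta>2 \<theta>2' \<phi>2 \<phi>2'"
    and eq: "\<And>x. x \<in> {0..c} \<Longrightarrow> \<phi>1 z x * \<theta>2 z x = \<phi>2 z x * \<theta>1 z x"
  shows "AE x in lebesgue. x \<in> {0..c} \<longrightarrow> q1 x = q2 x"
proof -
  interpret f1: fundamental_system q1 c \<theta>1 \<theta>1' \<phi>1 \<phi>1' by fact
  interpret f2: fundamental_system q2 c \<theta>2 \<theta>2' \<phi>2 \<phi>2' by fact
  note s1 = f1.sol_\<theta>[of z] f1.sol_\<phi>[of z] and s2 = f2.sol_\<theta>[of z] f2.sol_\<phi>[of z]
  have p: "is_primitive (\<theta>1 z) (\<theta>1' z) c" "is_primitive (\<phi>1 z) (\<phi>1' z) c"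
    "is_primitive (\<theta>2 z) (\<theta>2' z) c" "is_primitive (\<phi>2 z) (\<phi>2' z) c"
    using s1 s2 by (auto simp: ode_sol_def)
  have d: "(\<phi>1' z x * \<theta>2 z x + \<phi>1 z x * \<theta>2' z x) - (\<phi>2' z x * \<theta>1 z x + \<phi>2 z x * \<theta>1' z x) = 0"
    if "x \<in> {0..c}" for x
  proof (rule is_primitive_zero_continuous[OF _ _ f1.c_pos _ that])
    show "is_primitive (\<lambda>x. \<phi>1 z x * \<theta>2 z x - \<phi>2 z x * \<theta>1 z x)
      (\<lambda>x. (\<phi>1' z x * \<theta>2 z x + \<phi>1 z x * \<theta>2' z x) - (\<phi>2' z x * \<theta>1 z x + \<phi>2 z x * \<theta>1' z x)) c"
      by (intro is_primitive_minus is_primitive_mult p)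
    show "continuous_on {0..c} (\<lambda>x. (\<phi>1' z x * \<theta>2 z x + \<phi>1 z x * \<theta>2' z x) - (\<phi>2' z x * \<theta>1 z x + \<phi>2 z x * \<theta>1' z x))"
      using ode_sol_continuous[OF s1(1)] ode_sol_continuous[OF s1(2)]
        ode_sol_continuous[OF s2(1)] ode_sol_continuous[OF s2(2)]
      by (intro continuous_intros)
  qed (simp add: eq)
  \<comment> \<open>The relation, its derivative and the two Wronskians imply this polynomially,
    hence also at zeros of the solutions.\<close>
  have sq: "\<theta>1 z x * \<theta>1 z x = \<theta>2 z x * \<theta>2 z x" "\<phi>1 z x * \<phi>1 z x = \<phi>2 z x * \<phi>2 z x"
    if x: "x \<in> {0..c}" for x
    using eq[OF x] d[OF x] f1.wronskian[OF x, of z] f2.wronskian[OF x, of z] by algebra+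
  have "AE x in lebesgue. x \<in> {0..c} \<longrightarrow> \<theta>1 z x \<noteq> 0 \<longrightarrow> q1 x = q2 x"
    by (rule potentials_eq_AE_where_solution_nonzero[OF s1(1) s2(1) f1.c_pos sq(1)])
  moreover have "AE x in lebesgue. x \<in> {0..c} \<longrightarrow> \<phi>1 z x \<noteq> 0 \<longrightarrow> q1 x = q2 x"
    by (rule potentials_eq_AE_where_solution_nonzero[OF s1(2) s2(2) f1.c_pos sq(2)])
  ultimately show ?thesis
  proof eventually_elim
    case (elim x)
    then show ?case using f1.wronskian[of x z] by fastforce
  qed
qed

section \<open>Vanishing of the entire function \<open>F\<close> at interior points\<close>

text \<open>The strict inequality \<open>x < a\<close> lets the decay of the difference of the
  m-functions beat the product of \<open>\<phi>1\<close> and \<open>\<phi>2\<close>, which grows at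
  most like \<open>exp (2 * x * \<kappa>)\<close>.\<close>

lemma phi_theta_quotients_agree:
  assumes fs1: "fundamental_system q1 a \<theta>1 \<theta>1' \<phi>1 \<phi>1'" and fs2: "fundamental_system q2 a \<theta>2 \<theta>2' \<phi>2 \<phi>2'"
    and pot: "is_potential q1 b1 h1" "is_potential q2 b2 h2"
    and A1: "is_A_function q1 b1 h1 A1" and A2: "is_A_function q2 b2 h2 A2"
    and a: "0 < a" "ereal a \<le> b1" "ereal a \<le> b2"
    and eq: "AE \<alpha> in lebesgue. \<alpha> \<in> {0..a} \<longrightarrow> A1 \<alpha> = A2 \<alpha>"
    and x: "0 < x" "x < a"
  shows "\<phi>1 z x * \<theta>2 z x = \<phi>2 z x * \<theta>1 z x"
proof -
  interpret f1: fundamental_system q1 a \<theta>1 \<theta>1' \<phi>1 \<phi>1' by fact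
  interpret f2: fundamental_system q2 a \<theta>2 \<theta>2' \<phi>2 \<phi>2' by fact
  have xa: "x \<in> {0..a}" using x by simp
  define F where "F = (\<lambda>z. \<phi>1 z x * \<theta>2 z x - \<phi>2 z x * \<theta>1 z x)"
  define Q1 Q2 where "Q1 = exp (integral {0..a} (\<lambda>t. \<bar>q1 t\<bar>))" and "Q2 = exp (integral {0..a} (\<lambda>t. \<bar>q2 t\<bar>))"
  have Q: "Q1 > 0" "Q2 > 0" by (simp_all add: Q1_def Q2_def)
  note b1 = f1.exponential_bounds[OF _ xa, folded Q1_def] and b2 = f2.exponential_bounds[OF _ xa, folded Q2_def]
  have "F z = 0"
  proof (rule entire_exponential_type_zero[where F = F and B = "2 * x" and K = "2 * (Q1 * Q2)"])
    show "F holomorphic_on UNIV"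
      unfolding F_def
      using f1.ode_sol_holomorphic[OF f1.sol_\<theta> f1.init_\<theta> xa] f1.ode_sol_holomorphic[OF f1.sol_\<phi> f1.init_\<phi> xa]
        f2.ode_sol_holomorphic[OF f2.sol_\<theta> f2.init_\<theta> xa] f2.ode_sol_holomorphic[OF f2.sol_\<phi> f2.init_\<phi> xa]
      by (intro holomorphic_intros)
    show "norm (F (k\<^sup>2)) \<le> 2 * (Q1 * Q2) * exp (2 * x * \<bar>Im k\<bar>)" if k: "1 \<le> norm k" for k
    proof -
      define e where "e = exp (\<bar>Im k\<bar> * x)"
      have e: "e > 0" "e * e = exp (2 * x * \<bar>Im k\<bar>)" by (simp_all add: e_def flip: exp_add)
      have drop: "Q * e / norm k \<le> Q * e" if "Q > 0" for Q
        using that k e divide_left_mono[of 1 "norm k" "Q * e"] by force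
      have t: "norm (\<theta>1 (k\<^sup>2) x) \<le> Q1 * e" "norm (\<theta>2 (k\<^sup>2) x) \<le> Q2 * e"
        using b1(1)[OF k] b2(1)[OF k] by (simp_all add: e_def)
      have p: "norm (\<phi>1 (k\<^sup>2) x) \<le> Q1 * e" "norm (\<phi>2 (k\<^sup>2) x) \<le> Q2 * e"
        using b1(2)[OF k] b2(2)[OF k] drop[OF Q(1)] drop[OF Q(2)] by (simp_all add: e_def)
      have "norm (F (k\<^sup>2)) \<le> norm (\<phi>1 (k\<^sup>2) x) * norm (\<theta>2 (k\<^sup>2) x) + norm (\<phi>2 (k\<^sup>2) x) * norm (\<theta>1 (k\<^sup>2) x)"
        unfolding F_def norm_mult[symmetric] by (rule norm_triangle_ineq4)
      also have "\<dots> \<le> (Q1 * e) * (Q2 * e) + (Q2 * e) * (Q1 * e)"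
        using t p Q e by (intro add_mono mult_mono) auto
      also have "\<dots> = 2 * (Q1 * Q2) * (e * e)" by simp
      finally show ?thesis by (simp only: e)
    qed
    show "((\<lambda>\<kappa>. F (- (of_real \<kappa>)\<^sup>2)) \<longlongrightarrow> 0) at_top"
    proof -
      define m1 m2 where "m1 = (\<lambda>\<kappa>. m_function q1 b1 h1 (- (of_real \<kappa>)\<^sup>2))"
        and "m2 = (\<lambda>\<kappa>. m_function q2 b2 h2 (- (of_real \<kappa>)\<^sup>2))"
      define d where "d = (\<lambda>\<kappa>. norm (m1 \<kappa> - m2 \<kappa>) * exp (2 * x * \<kappa>))"
      have d: "(d \<longlongrightarrow> 0) at_top"
        unfolding d_def m1_def m2_def by (rule m_function_difference[OF A1 A2 a eq x])
      obtain K1 where K1: "eventually (\<lambda>\<kappa>. \<forall>x\<in>{0..a}.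
          norm (\<theta>1 (- (of_real \<kappa>)\<^sup>2) x + m1 \<kappa> * \<phi>1 (- (of_real \<kappa>)\<^sup>2) x) \<le> K1 * exp (- \<kappa> * x)) at_top"
        unfolding m1_def using weyl_solution_decay[OF fs1 pot(1) A1 a(1,2)] by blast
      obtain K2 where K2: "eventually (\<lambda>\<kappa>. \<forall>x\<in>{0..a}.
          norm (\<theta>2 (- (of_real \<kappa>)\<^sup>2) x + m2 \<kappa> * \<phi>2 (- (of_real \<kappa>)\<^sup>2) x) \<le> K2 * exp (- \<kappa> * x)) at_top"
        unfolding m2_def using weyl_solution_decay[OF fs2 pot(2) A2 a(1,3)] by blast
      have "((\<lambda>\<kappa>. (Q1 * K2 + Q2 * K1) / \<kappa> + Q1 * Q2 * d \<kappa>) \<longlongrightarrow> 0 + Q1 * Q2 * 0) at_top"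
        by (intro tendsto_intros d tendsto_divide_0[OF tendsto_const] filterlim_at_top_imp_at_infinity filterlim_ident)
      then have bound0: "((\<lambda>\<kappa>. (Q1 * K2 + Q2 * K1) / \<kappa> + Q1 * Q2 * d \<kappa>) \<longlongrightarrow> 0) at_top" by simp
      show ?thesis
      proof (rule Lim_null_comparison[OF _ bound0])
        show "eventually (\<lambda>\<kappa>. norm (F (- (of_real \<kappa>)\<^sup>2)) \<le> (Q1 * K2 + Q2 * K1) / \<kappa> + Q1 * Q2 * d \<kappa>) at_top"
          using K1 K2 eventually_ge_at_top[of 1]
        proof eventually_elim
          case (elim \<kappa>)
          define z where "z = (- (of_real \<kappa>)\<^sup>2 :: complex)"
          have z: "z = (\<i> * of_real \<kappa>)\<^sup>2" by (simp add: z_def power_mult_distrib)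
          define e where "e = exp (\<kappa> * x)"
          have e: "e > 0" "exp (- \<kappa> * x) = 1 / e" "e * e = exp (2 * x * \<kappa>)"
            by (simp_all add: e_def exp_minus field_simps flip: exp_add)
          have n: "1 \<le> norm (\<i> * of_real \<kappa>)" "norm (\<i> * of_real \<kappa>) = \<kappa>" "\<bar>Im (\<i> * of_real \<kappa>)\<bar> = \<kappa>"
            using elim(3) by (auto simp: norm_mult)
          have p: "norm (\<phi>1 z x) \<le> Q1 * e / \<kappa>" "norm (\<phi>2 z x) \<le> Q2 * e / \<kappa>"
            using b1(2)[OF n(1)] b2(2)[OF n(1)] unfolding n(2,3) z e_def by auto
          have psi: "norm (\<theta>1 z x + m1 \<kappa> * \<phi>1 z x) \<le> K1 / e" "norm (\<theta>2 z x + m2 \<kappa> * \<phi>2 z x) \<le> K2 / e"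
            using bspec[OF elim(1) xa] bspec[OF elim(2) xa] unfolding z_def e(2) by simp_all
          have "F z = \<phi>1 z x * (\<theta>2 z x + m2 \<kappa> * \<phi>2 z x) - \<phi>2 z x * (\<theta>1 z x + m1 \<kappa> * \<phi>1 z x)
              + (m1 \<kappa> - m2 \<kappa>) * (\<phi>1 z x * \<phi>2 z x)"
            by (simp add: F_def algebra_simps)
          also have "norm \<dots> \<le> (norm (\<phi>1 z x) * norm (\<theta>2 z x + m2 \<kappa> * \<phi>2 z x) + norm (\<phi>2 z x) * norm (\<theta>1 z x + m1 \<kappa> * \<phi>1 z x))
              + norm (m1 \<kappa> - m2 \<kappa>) * (norm (\<phi>1 z x) * norm (\<phi>2 z x))"
            unfolding norm_mult[symmetric]
            by (rule order_trans[OF norm_triangle_ineq add_right_mono[OF norm_triangle_ineq4]])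
          \<comment> \<open>In the products with Weyl solutions the exponentials cancel and the
            factor \<open>1 / \<kappa>\<close> of \<open>\<phi>\<close> gives the decay; in the last
            term the decay is that of \<open>d\<close>.\<close>
          also have "\<dots> \<le> (Q1 * e / \<kappa> * (K2 / e) + Q2 * e / \<kappa> * (K1 / e)) + norm (m1 \<kappa> - m2 \<kappa>) * ((Q1 * e) * (Q2 * e))"
          proof (intro add_mono mult_mono p psi mult_left_mono)
            have "Q * e / \<kappa> \<le> Q * e" if "Q > 0" for Q
              using that elim(3) e(1) divide_left_mono[of 1 \<kappa> "Q * e"] by simp
            then show "norm (\<phi>1 z x) \<le> Q1 * e" "norm (\<phi>2 z x) \<le> Q2 * e"
              using p Q by (meson order_trans)+
          qed (use Q e elim(3) in auto)
          also have "\<dots> = (Q1 * K2 + Q2 * K1) / \<kappa> + Q1 * Q2 * d \<kappa>"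
            using e(1) elim(3) unfolding d_def e(3)[symmetric] by (simp add: add_divide_distrib)
          finally show ?case by (simp add: z_def)
        qed
      qed
    qed
  qed (use x in simp)
  then show ?thesis by (simp add: F_def)
qed

theorem theorem1p5:
  fixes q1 q2 A1 A2 :: "real \<Rightarrow> real" and b1 b2 h1 h2 :: ereal and a :: real
  assumes "is_potential q1 b1 h1" and "is_potential q2 b2 h2"
    and "is_A_function q1 b1 h1 A1" and "is_A_function q2 b2 h2 A2"
    and "0 < a" and "ereal a < b1" and "ereal a < b2"
    and "AE \<alpha> in lebesgue. \<alpha> \<in> {0..a} \<longrightarrow> A1 \<alpha> = A2 \<alpha>"
  shows "AE x in lebesgue. x \<in> {0..a} \<longrightarrow> q1 x = q2 x"
proof -
  have a: "0 < a" "ereal a \<le> b1" "ereal a \<le> b2" using assms by auto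
  obtain \<theta>1 \<theta>1' \<phi>1 \<phi>1' where f1: "fundamental_system q1 a \<theta>1 \<theta>1' \<phi>1 \<phi>1'"
    using fundamental_system_exists is_potential_absolutely_integrable assms(1) a by metis
  obtain \<theta>2 \<theta>2' \<phi>2 \<phi>2' where f2: "fundamental_system q2 a \<theta>2 \<theta>2' \<phi>2 \<phi>2'"
    using fundamental_system_exists is_potential_absolutely_integrable assms(2) a by metis
  \<comment> \<open>A single spectral parameter suffices to recover the potential; 0 is an arbitrary
    choice.\<close>
  have ev: "\<phi>1 0 x * \<theta>2 0 x - \<phi>2 0 x * \<theta>1 0 x = 0" if "x \<in> {0<..<a}" for x
    using phi_theta_quotients_agree[OF f1 f2 assms(1-4) a assms(8), of x 0] that by simp
  have cont: "continuous_on {0..a} (\<lambda>x. \<phi>1 0 x * \<theta>2 0 x - \<phi>2 0 x * \<theta>1 0 x)"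
    using f1 f2 unfolding fundamental_system_def
    by (intro continuous_intros) (meson ode_sol_continuous(1))+
  \<comment> \<open>Continuity carries the identity over to the end points 0 and
    \<open>a\<close>.\<close>
  have "\<phi>1 0 x * \<theta>2 0 x - \<phi>2 0 x * \<theta>1 0 x = 0" if "x \<in> {0..a}" for x
    by (rule continuous_constant_on_closure[of "{0<..<a}" _ 0 x])
      (use ev cont that a(1) in auto)
  then show ?thesis
    by (intro potentials_eq_AE[OF f1 f2, of 0]) simp
qed

end
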